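(* Let $p$ be a prime and $x\in\mathbb R_{\rm C}$. (i) If $x$ is $\pm\infty$, or $r_+$ or $r_-$ for some $r\in\mathbb Q$, or a real quadratic irrational, then $\Phi_p(x)$ is algebraic of degree at most $2$ over $\mathbb F_p(q)$. (ii) If $\Phi_p(x)\in\mathbb P^1(\mathbb F_p(q))$, then $x$ is $\pm\infty$, or $r_+$ or $r_-$ for some $r\in\mathbb Q$, or a real quadratic irrational.
   Context: The Cantor line is $\mathbb R_{\rm C}:=(\mathbb R\setminus\mathbb Q)\sqcup\mathbb Q_+\sqcup\mathbb Q_-\sqcup\{-\infty,+\infty\}$, where each rational $r$ is doubled into $r_-$ and $r_+$. $[n]_q=\frac{1-q^n}{1-q}$. For real $x\ge1$ with its unique expansion $x=[[c_1,c_2,\ldots]]=c_1-\frac1{c_2-\frac{1}{c_3-\cdots}}$, integers $c_j\ge2$, $[x]_q\in\mathbb Z[[q]]$ is the $q$-adic limit of $[c_1]_q-\frac{q^{c_1-1}}{[c_2]_q-\cdots\frac{q^{c_{N-1}-1}}{[c_N]_q}}$; it is extended to all real $x$ with values in $\mathbb Z((q))$ by $[x+1]_q=q[x]_q+1$. For rational $r=[[c_1,\ldots,c_N]]>1$ (finite expansion, $c_i\ge2$), $[r]_q^-\in\mathbb Z[[q]]$ is obtained from $[c_1]_q-\frac{q^{c_1-1}}{[c_2]_q-\cdots\frac{q^{c_{N-1}-1}}{[c_N]_q}}$ by replacing the last entry $[c_N]_q$ with $[c_N]_q-q^{c_N-1}(1-q)$; it is extended to all $r\in\mathbb Q$ by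 $[r+1]_q^-=q[r]_q^-+1$. The map $\Phi_p:\mathbb R_{\rm C}\to\mathbb P^1(\mathbb F_p((q)))$ is: $\Phi_p(x)=[x]_q\bmod p$ for irrational $x$, $\Phi_p(r_+)=[r]_q\bmod p$, $\Phi_p(r_-)=[r]_q^-\bmod p$ for $r\in\mathbb Q$, $\Phi_p(+\infty)=(1-q)^{-1}$, $\Phi_p(-\infty)=\infty$ (coefficientwise reduction). The point $\infty$ is regarded as a rational point of $\mathbb P^1$ (degree $1$). *)

theory Defs
  imports
    "HOL-Analysis.Continuum_Not_Denumerable"
    "HOL-Computational_Algebra.Computational_Algebra"
    "Berlekamp_Zassenhaus.Finite_Field"
begin

typedef irrational = "{x :: real. x \<notin> \<rat>}"
proof -
  have "(\<rat> :: real set) \<noteq> UNIV"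
    using countable_rat uncountable_UNIV_real by metis
  then show ?thesis by auto
qed

datatype cantor_line =
    Irrational irrational
  | Rat_plus rat
  | Rat_minus rat
  | Plus_infinity
  | Minus_infinity

text \<open>An irrational real number satisfying a quadratic equation over the integers; irrationality is
  part of the argument type.\<close>

definition quadratic_irrational :: "irrational \<Rightarrow> bool" where
  "quadratic_irrational x \<longleftrightarrow>
     (\<exists>a b c :: int. a \<noteq> 0 \<and>
        of_int a * (Rep_irrational x)^2 + of_int b * Rep_irrational x + of_int c = 0)"

definition rational_or_quadratic :: "cantor_line \<Rightarrow> bool" where
  "rational_or_quadratic x \<longleftrightarrow>
     x = Plus_infinity \<or> x = Minus_infinity \<or>
     (\<exists>r. x = Rat_plus r \<or> x = Rat_minus r) \<or>
     (\<exists>y. x = Irrational y \<and> quadratic_irrational y)"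

text \<open>The value of \<open>[[c\<^sub>1, \<dots>, c\<^sub>N]]\<close>; the empty list is a dummy case.\<close>

fun neg_cf :: "nat list \<Rightarrow> 'a :: field" where
  "neg_cf [] = 0"
| "neg_cf [c] = of_nat c"
| "neg_cf (c # d # cs) = of_nat c - 1 / neg_cf (d # cs)"

text \<open>Every real \<open>x \<ge> 1\<close> has exactly one infinite expansion with entries at least 2.  This includes
  the rational numbers, whose infinite expansions end in \<open>2, 2, 2, \<dots>\<close>: the finite expansion
  \<open>[[c\<^sub>1, \<dots>, c\<^sub>N]]\<close> is equal to \<open>[[c\<^sub>1, \<dots>, c\<^sub>N + 1, 2, 2, \<dots>]]\<close>, and the two give the same \<open>q\<close>-number.
  Entries are indexed from 0.\<close>

definition neg_cf_expansion :: "real \<Rightarrow> nat \<Rightarrow> nat" where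
  "neg_cf_expansion x =
     (THE c. (\<forall>j. c j \<ge> 2) \<and> (\<lambda>N. neg_cf (map c [0..<Suc N])) \<longlonglongrightarrow> x)"

text \<open>Only meaningful for \<open>r > 1\<close>, where the expansion exists and is unique.\<close>

definition finite_neg_cf_expansion :: "rat \<Rightarrow> nat list" where
  "finite_neg_cf_expansion r = (THE cs. cs \<noteq> [] \<and> (\<forall>c \<in> set cs. c \<ge> 2) \<and> neg_cf cs = r)"

text \<open>The integers are not an instance of the class needed for division of power series.  In all
  uses below the denominator has constant coefficient 1, so that \<open>fps_right_inverse g 1\<close> is its
  inverse in \<open>\<int>[[q]]\<close>.\<close>

definition quot_fps :: "int fps \<Rightarrow> int fps \<Rightarrow> int fps" where
  "quot_fps f g = f * fps_right_inverse g 1"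

lemma quot_fps_mult_cancel: "fps_nth g 0 = 1 \<Longrightarrow> quot_fps f g * g = f"
  using fps_right_inverse[of g 1] by (simp add: quot_fps_def mult.assoc mult.commute[of _ g])

definition q_nat :: "nat \<Rightarrow> int fps" where
  "q_nat n = quot_fps (1 - fps_X ^ n) (1 - fps_X)"

text \<open>The \<open>q\<close>-deformed finite continued fraction, whose last entry \<open>c\<close> contributes \<open>e c\<close>.\<close>

fun q_neg_cf :: "(nat \<Rightarrow> int fps) \<Rightarrow> nat list \<Rightarrow> int fps" where
  "q_neg_cf e [] = 0"
| "q_neg_cf e [c] = e c"
| "q_neg_cf e (c # d # cs) = q_nat c - quot_fps (fps_X ^ (c - 1)) (q_neg_cf e (d # cs))"

text \<open>The metric on formal power series is the \<open>q\<close>-adic one.  Outside the range of the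
  continued fraction definition, the recursion solves \<open>[x + 1]\<^sub>q = q [x]\<^sub>q + 1\<close> for \<open>[x]\<^sub>q\<close>.\<close>

function q_real :: "real \<Rightarrow> int fls" where
  "q_real x =
     (if x \<ge> 1
      then fps_to_fls (lim (\<lambda>N. q_neg_cf q_nat (map (neg_cf_expansion x) [0..<Suc N])))
      else fls_X_inv * (q_real (x + 1) - 1))"
  by auto
termination by (relation "measure (\<lambda>x. nat \<lceil>1 - x\<rceil>)") (auto, linarith)

function q_rat_minus :: "rat \<Rightarrow> int fls" where
  "q_rat_minus r =
     (if r > 1
      then fps_to_fls (q_neg_cf (\<lambda>c. q_nat c - fps_X ^ (c - 1) * (1 - fps_X))
             (finite_neg_cf_expansion r))
      else fls_X_inv * (q_rat_minus (r + 1) - 1))"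
  by auto
termination by (relation "measure (\<lambda>r. nat \<lfloor>2 - r\<rfloor>)") (auto, linarith)

declare q_real.simps [simp del] q_rat_minus.simps [simp del]

definition reduce_fls :: "int fls \<Rightarrow> 'a :: ring_1 fls" where
  "reduce_fls f = Abs_fls (\<lambda>n. of_int (fls_nth f n))"

lemma reduce_fls_nth: "fls_nth (reduce_fls f) n = of_int (fls_nth f n)"
proof -
  have "\<forall>n < fls_subdegree f. (of_int (fls_nth f n) :: 'a) = 0"
    by simp
  then show ?thesis
    unfolding reduce_fls_def by (rule nth_Abs_fls_lower_bound)
qed

datatype 'a proj_line = Finite_pt 'a | Infinity_pt

text \<open>The field \<open>F\<^sub>p\<close> is the type \<open>'p mod_ring\<close>, where the cardinality of \<open>'p\<close> is the prime \<open>p\<close>.\<close>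

fun Phi :: "cantor_line \<Rightarrow> 'p :: prime_card mod_ring fls proj_line" where
  "Phi (Irrational x) = Finite_pt (reduce_fls (q_real (Rep_irrational x)))"
| "Phi (Rat_plus r) = Finite_pt (reduce_fls (q_real (of_rat r)))"
| "Phi (Rat_minus r) = Finite_pt (reduce_fls (q_rat_minus r))"
| "Phi Plus_infinity = Finite_pt (inverse (1 - fls_X))"
| "Phi Minus_infinity = Infinity_pt"

text \<open>The field \<open>k(q)\<close> as a subfield of \<open>k((q))\<close>.\<close>

definition rational_functions :: "'a :: field fls set" where
  "rational_functions =
     {fps_to_fls (fps_of_poly a) / fps_to_fls (fps_of_poly b) | a b. b \<noteq> 0}"

definition proj_points :: "'a set \<Rightarrow> 'a proj_line set" where
  "proj_points K = insert Infinity_pt (Finite_pt ` K)"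

definition annihilating_polys :: "'a :: field set \<Rightarrow> 'a \<Rightarrow> 'a poly set" where
  "annihilating_polys K y = {P. P \<noteq> 0 \<and> (\<forall>i. Polynomial.coeff P i \<in> K) \<and> poly P y = 0}"

definition algebraic_over :: "'a :: field set \<Rightarrow> 'a \<Rightarrow> bool" where
  "algebraic_over K y \<longleftrightarrow> annihilating_polys K y \<noteq> {}"

text \<open>The degree of the minimal polynomial; only meaningful for algebraic elements.\<close>

definition algebraic_degree :: "'a :: field set \<Rightarrow> 'a \<Rightarrow> nat" where
  "algebraic_degree K y = (LEAST n. \<exists>P \<in> annihilating_polys K y. degree P = n)"

fun proj_algebraic_over :: "'a :: field set \<Rightarrow> 'a proj_line \<Rightarrow> bool" where
  "proj_algebraic_over K (Finite_pt y) \<longleftrightarrow> algebraic_over K y"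
| "proj_algebraic_over K Infinity_pt \<longleftrightarrow> True"

fun proj_algebraic_degree :: "'a :: field set \<Rightarrow> 'a proj_line \<Rightarrow> nat" where
  "proj_algebraic_degree K (Finite_pt y) = algebraic_degree K y"
| "proj_algebraic_degree K Infinity_pt = 1"

end

theory Submission
  imports Defs
begin

text \<open>
  Everything rests on the shift \<open>T x = 1 / (\<lfloor>x\<rfloor> + 1 - x)\<close> of negative continued fractions.  A real number
  \<open>x \<ge> 1\<close> with entries \<open>c\<^sub>0, c\<^sub>1, \<dots>\<close> and its deformation satisfy parallel recursions,
  \<open>x = c\<^sub>0 - 1 / T x\<close> and \<open>[x]\<^sub>q = [c\<^sub>0]\<^sub>q - q\<^sup>c\<^sup>-\<^sup>1 / [T x]\<^sub>q\<close> with \<open>c = c\<^sub>0\<close>.  If the orbit of \<open>x\<close> under \<open>T\<close> is finite, it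
  is eventually periodic, and both recursions become fixed point equations of Moebius transformations
  that are not scalar.  So \<open>x\<close> then satisfies a quadratic equation over \<open>\<int>\<close>, and the reduction of
  \<open>[x]\<^sub>q\<close> satisfies one over \<open>F\<^sub>p(q)\<close> (\<open>eventually_periodic_quadratic\<close>).  Rational numbers count as quadratic
  here.

  For the first claim it remains to show that orbits of quadratic numbers are finite.  This
  is Lagrange's theorem for negative continued fractions: the discriminant is constant along the
  orbit, after finitely many steps 1 separates the number from its conjugate, and there are only
  finitely many such numbers of a given discriminant (\<open>quadratic_finite_orbit\<close>).  The right
  versions \<open>[r]\<^sub>q\<close> of rational numbers are covered by their infinite expansions; the left versions are
  finite continued fractions and hence rational functions.

  For the second claim, suppose that the reduction of \<open>[x]\<^sub>q\<close> is a fraction \<open>a / b\<close> of polynomials.  Then the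
  reduction of \<open>[T x]\<^sub>q\<close> is a fraction \<open>b / d\<close>, and the degrees do not grow (\<open>fraction_of_degree_step\<close>).
  Over a finite field only finitely many series can occur along the orbit.  The reduced
  series determines the continued fraction (\<open>reduced_limit_inject\<close>), so the orbit of \<open>x\<close> is finite
  and \<open>x\<close> is quadratic.

  Numbers below 1 reduce to this case by \<open>[x + 1]\<^sub>q = q [x]\<^sub>q + 1\<close>, since affine substitutions preserve
  being quadratic and being rational.
\<close>

section \<open>Negative continued fractions of real numbers\<close>

definition expands_to :: "(nat \<Rightarrow> nat) \<Rightarrow> real \<Rightarrow> bool" where
  "expands_to c x \<longleftrightarrow>
     (\<forall>j. c j \<ge> 2) \<and> (\<lambda>N. neg_cf (map c [0..<Suc N])) \<longlonglongrightarrow> x"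

lemma neg_cf_Cons:
  "cs \<noteq> [] \<Longrightarrow> neg_cf (c # cs) = of_nat c - 1 / neg_cf cs"
  by (cases cs) simp_all

lemma neg_cf_bounds:
  fixes cs :: "nat list"
  assumes "cs \<noteq> []" "\<forall>c \<in> set cs. c \<ge> 2"
  shows "1 < (neg_cf cs :: real)" "neg_cf cs \<le> real (hd cs)"
proof -
  have "1 < (neg_cf cs :: real) \<and> neg_cf cs \<le> real (hd cs)"
    using assms
  proof (induction cs rule: neg_cf.induct)
    case (3 c d cs)
    then have tail: "1 < (neg_cf (d # cs) :: real)" and c: "2 \<le> real c" by auto
    then have "0 < 1 / (neg_cf (d # cs) :: real)" "1 / (neg_cf (d # cs) :: real) < 1"
      by (auto simp: field_simps)
    then show ?case using c unfolding neg_cf.simps list.sel by linarith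
  qed auto
  then show "1 < (neg_cf cs :: real)" "neg_cf cs \<le> real (hd cs)" by auto
qed

text \<open>Every tail of the expansion has a value in the interval from 1 to its own first entry.
  The upper bound keeps its reciprocal away from 0, so the limit \<open>x\<close> lies strictly below \<open>c 0\<close>;
  this strictness is what makes the first entry a function of \<open>x\<close>.\<close>

lemma expands_to_step:
  assumes "expands_to c x"
  shows "\<lfloor>x\<rfloor> = int (c 0) - 1"
    and "expands_to (\<lambda>j. c (Suc j)) (1 / (real (c 0) - x))"
proof -
  define t where "t N = (neg_cf (map (\<lambda>j. c (Suc j)) [0..<Suc N]) :: real)" for N
  have c: "c j \<ge> 2" for j
    using assms by (simp add: expands_to_def)
  have lim: "(\<lambda>N. neg_cf (map c [0..<Suc N])) \<longlonglongrightarrow> x"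
    using assms by (auto simp: expands_to_def)
  have t: "1 < t N" "t N \<le> real (c 1)" for N
    using neg_cf_bounds[of "map (\<lambda>j. c (Suc j)) [0..<Suc N]"] c
    unfolding t_def by (auto simp: map_upt_Suc simp del: upt_Suc)
  have rec: "neg_cf (map c [0..<Suc (Suc N)]) = real (c 0) - 1 / t N" for N
    unfolding t_def by (subst map_upt_Suc) (simp add: neg_cf_Cons del: upt_Suc)
  have "(\<lambda>N. real (c 0) - 1 / t N) \<longlonglongrightarrow> x"
    using LIMSEQ_Suc[OF lim] by (simp only: rec)
  then have inv: "(\<lambda>N. 1 / t N) \<longlonglongrightarrow> real (c 0) - x"
    using tendsto_diff[OF tendsto_const[of "real (c 0)"]] by fastforce
  have "1 / real (c 1) \<le> 1 / t N" "1 / t N \<le> 1" for N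
    using t[of N] by (auto simp: field_simps)
  then have "1 / real (c 1) \<le> real (c 0) - x" and le: "real (c 0) - x \<le> 1"
    using LIMSEQ_le_const[OF inv] LIMSEQ_le_const2[OF inv] by blast+
  moreover have "0 < 1 / real (c 1)" using c[of 1] by simp
  ultimately have pos: "0 < real (c 0) - x" by linarith
  from pos le show "\<lfloor>x\<rfloor> = int (c 0) - 1" by (intro floor_unique) auto
  have "(\<lambda>N. 1 / (1 / t N)) \<longlonglongrightarrow> 1 / (real (c 0) - x)"
    using pos by (intro tendsto_divide[OF tendsto_const inv]) auto
  then show "expands_to (\<lambda>j. c (Suc j)) (1 / (real (c 0) - x))"
    using c by (simp add: expands_to_def t_def del: upt_Suc)
qed

lemma expands_to_unique:
  assumes "expands_to c x" "expands_to d x"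
  shows "c = d"
proof
  show "c n = d n" for n using assms
  proof (induction n arbitrary: c d x)
    case 0
    then show ?case using expands_to_step(1)[of c x] expands_to_step(1)[of d x] by simp
  next
    case (Suc n)
    have "c 0 = d 0"
      using expands_to_step(1)[OF Suc.prems(1)] expands_to_step(1)[OF Suc.prems(2)] by simp
    then show ?case
      using Suc.IH[OF expands_to_step(2)[OF Suc.prems(1)]] expands_to_step(2)[OF Suc.prems(2)]
      by simp
  qed
qed

text \<open>The shift on negative continued fractions: by \<open>expands_to_step\<close>, it deletes the first entry.\<close>

definition neg_gauss :: "real \<Rightarrow> real" where
  "neg_gauss x = 1 / (of_int \<lfloor>x\<rfloor> + 1 - x)"

definition digit :: "real \<Rightarrow> nat \<Rightarrow> nat" where
  "digit x n = nat (\<lfloor>(neg_gauss ^^ n) x\<rfloor> + 1)"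

lemma digit_Suc: "digit x (Suc n) = digit (neg_gauss x) n"
  by (simp add: digit_def funpow_Suc_right del: funpow.simps)

lemma neg_gauss_ge_1: "neg_gauss x \<ge> 1"
proof -
  have "0 < of_int \<lfloor>x\<rfloor> + 1 - x" "of_int \<lfloor>x\<rfloor> + 1 - x \<le> 1" by linarith+
  then show ?thesis unfolding neg_gauss_def by (simp add: le_divide_eq_1_pos)
qed

lemma orbit_ge_1: "x \<ge> 1 \<Longrightarrow> (neg_gauss ^^ n) x \<ge> 1"
  by (cases n) (auto simp: neg_gauss_ge_1)

lemma digit_ge_2: "x \<ge> 1 \<Longrightarrow> digit x n \<ge> 2"
  using orbit_ge_1[of x n] unfolding digit_def by (simp add: le_nat_iff le_floor_iff)

lemma real_digit: "x \<ge> 1 \<Longrightarrow> real (digit x n) = of_int \<lfloor>(neg_gauss ^^ n) x\<rfloor> + 1"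
  using orbit_ge_1[of x n] unfolding digit_def by (simp add: le_floor_iff)

lemma orbit_step:
  assumes "x \<ge> 1"
  shows "(neg_gauss ^^ n) x = real (digit x n) - 1 / (neg_gauss ^^ Suc n) x"
  using real_digit[OF assms, of n] by (simp add: neg_gauss_def)

text \<open>If the tail is off by \<open>e\<close> and the exact tail \<open>y\<close> is at least 1, then the whole fraction is off by
  \<open>e / (y (y + e)) \<le> e / (1 + e)\<close>, and the map \<open>e \<mapsto> e / (1 + e)\<close> sends \<open>1 / n\<close> to \<open>1 / (n + 1)\<close>.  This
  harmonic rate is attained for \<open>x = 1\<close>, where all entries are 2.\<close>

lemma expansion_error:
  assumes "x \<ge> 1"
  shows "0 \<le> neg_cf (map (digit x) [0..<Suc N]) - x \<and>
         neg_cf (map (digit x) [0..<Suc N]) - x \<le> 1 / real (Suc N)"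
  using assms
proof (induction N arbitrary: x)
  case 0
  have "neg_cf (map (digit x) [0..<Suc 0]) = of_int \<lfloor>x\<rfloor> + (1 :: real)"
    using real_digit[OF 0, of 0] by simp
  moreover have "0 \<le> of_int \<lfloor>x\<rfloor> + 1 - x" "of_int \<lfloor>x\<rfloor> + 1 - x \<le> 1" by linarith+
  ultimately show ?case by simp
next
  case (Suc N)
  define y where "y = neg_gauss x"
  define t where "t = (neg_cf (map (digit y) [0..<Suc N]) :: real)"
  have y: "y \<ge> 1" unfolding y_def by (rule neg_gauss_ge_1)
  have IH: "0 \<le> t - y" "t - y \<le> 1 / real (Suc N)"
    using Suc.IH[OF y] unfolding t_def by auto
  have "neg_cf (map (digit x) [0..<Suc (Suc N)]) = real (digit x 0) - 1 / t"
    unfolding t_def y_def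
    by (subst map_upt_Suc) (simp add: neg_cf_Cons digit_Suc del: upt_Suc)
  moreover have "x = real (digit x 0) - 1 / y"
    using orbit_step[OF Suc.prems, of 0] by (simp add: y_def)
  ultimately have err: "neg_cf (map (digit x) [0..<Suc (Suc N)]) - x = 1 / y - 1 / t"
    by linarith
  have "1 / t \<le> 1 / y" using y IH by (intro divide_left_mono) auto
  have "1 / y - 1 / t = (t - y) / (y * t)" using y IH by (simp add: field_simps)
  also have "\<dots> \<le> (t - y) / (1 + (t - y))"
  proof (rule divide_left_mono)
    have "1 * t \<le> y * t" using y IH by (intro mult_right_mono) auto
    then show "1 + (t - y) \<le> y * t" using y by linarith
  qed (use y IH in auto)
  also have "\<dots> = 1 - 1 / (1 + (t - y))" using IH by (simp add: field_simps)
  also have "\<dots> \<le> 1 - 1 / (1 + 1 / real (Suc N))"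
    using IH by (intro diff_left_mono divide_left_mono) auto
  also have "\<dots> = 1 / real (Suc (Suc N))" by (simp add: field_simps)
  finally show ?case using err \<open>1 / t \<le> 1 / y\<close> by simp
qed

lemma expands_to_digit:
  assumes "x \<ge> 1" shows "expands_to (digit x) x"
proof -
  have "(\<lambda>N. neg_cf (map (digit x) [0..<Suc N]) - x) \<longlonglongrightarrow> 0"
  proof (rule tendsto_sandwich[OF _ _ tendsto_const])
    show "(\<lambda>N. 1 / real (Suc N)) \<longlonglongrightarrow> 0"
      using LIMSEQ_inverse_real_of_nat by (simp add: divide_simps)
  qed (use expansion_error[OF assms] in auto)
  then show ?thesis
    using digit_ge_2[OF assms] by (simp add: expands_to_def LIM_zero_iff del: upt_Suc)
qed

lemma neg_cf_expansion_eq_digit: "x \<ge> 1 \<Longrightarrow> neg_cf_expansion x = digit x"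
  unfolding neg_cf_expansion_def expands_to_def[symmetric]
  by (rule the_equality) (auto intro: expands_to_digit expands_to_unique)

lemma digit_inject:
  assumes "x \<ge> 1" "y \<ge> 1" "digit x = digit y"
  shows "x = y"
  using expands_to_digit[OF assms(1)] expands_to_digit[OF assms(2)] assms(3)
  by (auto simp: expands_to_def intro: LIMSEQ_unique)

section \<open>Elements of degree at most two and periodic Moebius recursions\<close>

text \<open>The coefficients may come from a mere ring, and the relation may be linear.  This makes one notion
  serve for real numbers over \<open>\<int>\<close> and for Laurent series over \<open>k(q)\<close>, with rational numbers and rational
  functions included.\<close>

definition quadratic_over :: "'a :: field set \<Rightarrow> 'a \<Rightarrow> bool" where
  "quadratic_over K y \<longleftrightarrow>
     (\<exists>a\<in>K. \<exists>b\<in>K. \<exists>c\<in>K. (a \<noteq> 0 \<or> b \<noteq> 0 \<or> c \<noteq> 0) \<and> a * y^2 + b * y + c = 0)"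

lemma quadratic_overI:
  assumes "a \<in> K" "b \<in> K" "c \<in> K" "a \<noteq> 0 \<or> b \<noteq> 0 \<or> c \<noteq> 0" "a * y^2 + b * y + c = 0"
  shows "quadratic_over K y"
  using assms unfolding quadratic_over_def by blast

lemma quadratic_over_algebraic:
  assumes K: "0 \<in> K" and y: "quadratic_over K y"
  shows "algebraic_over K y" "algebraic_degree K y \<le> 2"
proof -
  obtain a b c where abc: "a \<in> K" "b \<in> K" "c \<in> K" "a \<noteq> 0 \<or> b \<noteq> 0 \<or> c \<noteq> 0"
    and root: "a * y^2 + b * y + c = 0"
    using y unfolding quadratic_over_def by blast
  define P where "P = [:c, b, a:]"
  have "poly P y = 0" using root by (simp add: P_def algebra_simps power2_eq_square)
  moreover have "\<forall>i. Polynomial.coeff P i \<in> K"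
    using abc K by (simp add: P_def coeff_pCons split: nat.split)
  ultimately have P: "P \<in> annihilating_polys K y"
    using abc unfolding annihilating_polys_def by (auto simp: P_def)
  then show "algebraic_over K y" unfolding algebraic_over_def by blast
  have "algebraic_degree K y \<le> degree P"
    unfolding algebraic_degree_def using P by (intro Least_le) blast
  also have "degree P \<le> 2" by (simp add: P_def)
  finally show "algebraic_degree K y \<le> 2" .
qed

locale coefficient_ring =
  fixes K :: "'a :: field set"
  assumes one_closed [simp]: "1 \<in> K"
    and add_closed [simp]: "a \<in> K \<Longrightarrow> b \<in> K \<Longrightarrow> a + b \<in> K"
    and uminus_closed [simp]: "a \<in> K \<Longrightarrow> - a \<in> K"
    and mult_closed [simp]: "a \<in> K \<Longrightarrow> b \<in> K \<Longrightarrow> a * b \<in> K"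
begin

lemma diff_closed [simp]: "a \<in> K \<Longrightarrow> b \<in> K \<Longrightarrow> a - b \<in> K"
  using add_closed[of a "- b"] by simp

lemma zero_closed [simp]: "0 \<in> K"
  using diff_closed[of 1 1] by simp

lemma power_closed [simp]: "a \<in> K \<Longrightarrow> a ^ n \<in> K"
  by (induction n) simp_all

lemma member_quadratic: "y \<in> K \<Longrightarrow> quadratic_over K y"
  by (rule quadratic_overI[of 0 K 1 "- y"]) simp_all

text \<open>Substitute \<open>y = (z - v) / u\<close> and clear denominators.\<close>

lemma quadratic_affine:
  assumes y: "quadratic_over K y" and u: "u \<in> K" "u \<noteq> 0" and v: "v \<in> K"
  shows "quadratic_over K (u * y + v)"
proof -
  from y obtain a b c where K: "a \<in> K" "b \<in> K" "c \<in> K"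
    and nz: "a \<noteq> 0 \<or> b \<noteq> 0 \<or> c \<noteq> 0" and root: "a * y^2 + b * y + c = 0"
    unfolding quadratic_over_def by blast
  let ?b = "b * u - (a * v + a * v)" and ?c = "a * v^2 - b * u * v + c * u^2"
  have b: "?b \<in> K" and c: "?c \<in> K"
    by (intro diff_closed add_closed mult_closed power_closed K u v)+
  have "a * (u * y + v)^2 + ?b * (u * y + v) + ?c = u^2 * (a * y^2 + b * y + c)"
    by (simp add: algebra_simps power2_eq_square)
  moreover have "a \<noteq> 0 \<or> ?b \<noteq> 0 \<or> ?c \<noteq> 0"
    using nz u by auto
  ultimately show ?thesis
    using K(1) b c root by (intro quadratic_overI[of a K ?b ?c]) simp_all
qed

lemma quadratic_inverse:
  assumes "quadratic_over K y"
  shows "quadratic_over K (inverse y)"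
proof (cases "y = 0")
  case False
  from assms obtain a b c where K: "a \<in> K" "b \<in> K" "c \<in> K"
    and nz: "a \<noteq> 0 \<or> b \<noteq> 0 \<or> c \<noteq> 0" and root: "a * y^2 + b * y + c = 0"
    unfolding quadratic_over_def by blast
  have "c * (inverse y)^2 + b * inverse y + a = (a * y^2 + b * y + c) * (inverse y)^2"
    using False by (simp add: field_simps power2_eq_square)
  then show ?thesis
    using K nz root by (intro quadratic_overI[of c K b a]) auto
qed (use assms in simp)

text \<open>The relation \<open>\<alpha>\<^sub>j \<alpha>\<^sub>j\<^sub>+\<^sub>1 = u\<^sub>j \<alpha>\<^sub>j\<^sub>+\<^sub>1 - v\<^sub>j\<close> says that \<open>\<alpha>\<^sub>j\<close> is the image of \<open>\<alpha>\<^sub>j\<^sub>+\<^sub>1\<close> under the Moebius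
  transformation with rows \<open>(u\<^sub>j, - v\<^sub>j)\<close> and \<open>(1, 0)\<close>.  The numbers \<open>P, Q, R, S\<close> are the entries of a
  product of such matrices.  The predicate \<open>I\<close> is an invariant of the bottom row under right
  multiplication by a further matrix; instances use it to see that \<open>R\<close> does not vanish.\<close>

lemma moebius_composition:
  assumes rec: "\<And>j. \<alpha> j * \<alpha> (Suc j) = u j * \<alpha> (Suc j) - v j"
    and K: "\<And>j. u j \<in> K" "\<And>j. v j \<in> K"
    and I: "I 1 0" "\<And>R S j. I R S \<Longrightarrow> I (R * u j + S) (- (R * v j))"
  shows "\<exists>P\<in>K. \<exists>Q\<in>K. \<exists>R\<in>K. \<exists>S\<in>K. I R S \<and>
           \<alpha> m * (R * \<alpha> (m + Suc k) + S) = P * \<alpha> (m + Suc k) + Q"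
proof (induction k)
  case 0
  show ?case
    by (rule bexI[of _ "u m"], rule bexI[of _ "- v m"], rule bexI[of _ 1], rule bexI[of _ 0])
       (use rec K I in simp_all)
next
  case (Suc k)
  define n where "n = m + Suc k"
  from Suc.IH obtain P Q R S where PQRS: "P \<in> K" "Q \<in> K" "R \<in> K" "S \<in> K" "I R S"
    and eq: "\<alpha> m * (R * \<alpha> n + S) = P * \<alpha> n + Q"
    unfolding n_def by blast
  have "\<alpha> m * (R * (\<alpha> n * \<alpha> (Suc n)) + S * \<alpha> (Suc n)) = (\<alpha> m * (R * \<alpha> n + S)) * \<alpha> (Suc n)"
    by (simp add: algebra_simps)
  also have "\<dots> = P * (\<alpha> n * \<alpha> (Suc n)) + Q * \<alpha> (Suc n)"
    unfolding eq by (simp add: algebra_simps)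
  finally have "\<alpha> m * ((R * u n + S) * \<alpha> (Suc n) + - (R * v n)) =
      (P * u n + Q) * \<alpha> (Suc n) + - (P * v n)"
    by (simp add: rec algebra_simps)
  moreover have "I (R * u n + S) (- (R * v n))" using I(2) PQRS(5) .
  ultimately have "I (R * u n + S) (- (R * v n)) \<and>
      \<alpha> m * ((R * u n + S) * \<alpha> (m + Suc (Suc k)) + - (R * v n)) =
      (P * u n + Q) * \<alpha> (m + Suc (Suc k)) + - (P * v n)"
    unfolding n_def by simp
  moreover have "P * u n + Q \<in> K" "- (P * v n) \<in> K" "R * u n + S \<in> K" "- (R * v n) \<in> K"
    using PQRS K by simp_all
  ultimately show ?case by blast
qed

text \<open>A point fixed by a Moebius transformation with \<open>R \<noteq> 0\<close> satisfies the fixed point equation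
  \<open>R \<alpha>\<^sup>2 + (S - P) \<alpha> - Q = 0\<close>, which is not the trivial one.  The preperiod is undone one step at
  a time.\<close>

lemma eventually_periodic_quadratic:
  assumes rec: "\<And>j. \<alpha> j * \<alpha> (Suc j) = u j * \<alpha> (Suc j) - v j"
    and K: "\<And>j. u j \<in> K" "\<And>j. v j \<in> K"
    and nz: "\<And>j. \<alpha> j \<noteq> 0" "\<And>j. v j \<noteq> 0"
    and I: "I 1 0" "\<And>R S j. I R S \<Longrightarrow> I (R * u j + S) (- (R * v j))" "\<And>R S. I R S \<Longrightarrow> R \<noteq> 0"
    and per: "\<alpha> (m + Suc k) = \<alpha> m"
  shows "quadratic_over K (\<alpha> 0)"
proof -
  have "\<exists>P\<in>K. \<exists>Q\<in>K. \<exists>R\<in>K. \<exists>S\<in>K. I R S \<and>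
      \<alpha> m * (R * \<alpha> (m + Suc k) + S) = P * \<alpha> (m + Suc k) + Q"
    by (rule moebius_composition[where u = u and v = v]) (use rec K I in simp_all)
  then obtain P Q R S where PQRS: "P \<in> K" "Q \<in> K" "R \<in> K" "S \<in> K" "R \<noteq> 0"
    and eq: "\<alpha> m * (R * \<alpha> m + S) = P * \<alpha> m + Q"
    unfolding per using I(3) by blast
  have "R * (\<alpha> m)^2 + (S - P) * \<alpha> m + (- Q) = 0"
    using eq by (simp add: algebra_simps power2_eq_square)
  then have "quadratic_over K (\<alpha> m)"
    using PQRS by (intro quadratic_overI[of R K "S - P" "- Q"]) auto
  then show ?thesis
  proof (induction m)
    case (Suc m)
    have "\<alpha> m = (- v m) * inverse (\<alpha> (Suc m)) + u m"
      using rec[of m] nz(1)[of "Suc m"] by (simp add: field_simps)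
    moreover have "quadratic_over K ((- v m) * inverse (\<alpha> (Suc m)) + u m)"
      using K nz Suc.prems by (intro quadratic_affine quadratic_inverse) auto
    ultimately show ?case using Suc.IH by simp
  qed
qed

end

interpretation Ints: coefficient_ring "\<int> :: 'a :: field set"
  by standard auto

text \<open>For an irrational number a nontrivial relation cannot be linear.\<close>

lemma irrational_quadratic_iff:
  fixes x :: real
  assumes "x \<notin> \<rat>"
  shows "quadratic_over \<int> x \<longleftrightarrow>
    (\<exists>a b c :: int. a \<noteq> 0 \<and> of_int a * x^2 + of_int b * x + of_int c = 0)"
proof
  assume "quadratic_over \<int> x"
  then obtain a b c :: int where nz: "a \<noteq> 0 \<or> b \<noteq> 0 \<or> c \<noteq> 0"
    and root: "of_int a * x^2 + of_int b * x + of_int c = 0"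
    unfolding quadratic_over_def Ints_def by auto
  have "a \<noteq> 0"
  proof
    assume "a = 0"
    with nz root have "b \<noteq> 0" by auto
    then have "x = - of_int c / of_int b"
      using root \<open>a = 0\<close> by (simp add: field_simps)
    then have "x \<in> \<rat>" by simp
    then show False using assms by simp
  qed
  then show "\<exists>a b c :: int. a \<noteq> 0 \<and> of_int a * x^2 + of_int b * x + of_int c = 0"
    using root by blast
next
  assume "\<exists>a b c :: int. a \<noteq> 0 \<and> of_int a * x^2 + of_int b * x + of_int c = 0"
  then obtain a b c :: int where "a \<noteq> 0" "of_int a * x^2 + of_int b * x + of_int c = 0"
    by blast
  then show "quadratic_over \<int> x"
    by (intro quadratic_overI[of "of_int a" _ "of_int b" "of_int c"]) auto
qed

lemma rational_quadratic_over_Ints: "(x :: real) \<in> \<rat> \<Longrightarrow> quadratic_over \<int> x"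
proof -
  assume "x \<in> \<rat>"
  then obtain u v :: int where "v > 0" "x = of_int u / of_int v"
    by (rule Rats_cases') blast
  then show ?thesis by (intro quadratic_overI[of 0 _ "of_int v" "- of_int u"]) auto
qed

lemma quadratic_irrational_iff:
  "quadratic_irrational y \<longleftrightarrow> quadratic_over \<int> (Rep_irrational y)"
  using irrational_quadratic_iff[of "Rep_irrational y"] Rep_irrational[of y]
  by (simp add: quadratic_irrational_def)

text \<open>The bottom row \<open>(R, S)\<close> of a product of the matrices with rows \<open>(c, - 1)\<close> and \<open>(1, 0)\<close> has
  \<open>R \<ge> 1\<close>; the induction also needs \<open>R + S \<ge> 1\<close>, since the new \<open>R\<close> is \<open>R (c - 1) + (R + S)\<close>.\<close>

lemma periodic_orbit_quadratic:
  assumes x: "x \<ge> 1" and per: "(neg_gauss ^^ (m + Suc k)) x = (neg_gauss ^^ m) x"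
  shows "quadratic_over \<int> x"
proof -
  let ?I = "\<lambda>R S :: real. 1 \<le> R \<and> 1 \<le> R + S"
  have "quadratic_over \<int> ((neg_gauss ^^ 0) x)"
  proof (rule Ints.eventually_periodic_quadratic[where \<alpha> = "\<lambda>j. (neg_gauss ^^ j) x"
        and u = "\<lambda>j. real (digit x j)" and v = "\<lambda>j. 1" and I = ?I])
    fix j
    show "(neg_gauss ^^ j) x * (neg_gauss ^^ Suc j) x = real (digit x j) * (neg_gauss ^^ Suc j) x - 1"
      using orbit_step[OF x, of j] orbit_ge_1[OF x, of "Suc j"] by (simp add: field_simps)
    show "(neg_gauss ^^ j) x \<noteq> 0" using orbit_ge_1[OF x, of j] by simp
  next
    fix R S :: real and j assume I: "?I R S"
    have c: "2 \<le> real (digit x j)" using digit_ge_2[OF x, of j] by simp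
    have "R * 2 \<le> R * real (digit x j)" using c I by (intro mult_left_mono) auto
    then show "?I (R * real (digit x j) + S) (- (R * 1))" using I by (intro conjI) linarith+
  qed (use per in auto)
  then show ?thesis by simp
qed

section \<open>Finiteness of the orbits of rational and quadratic numbers\<close>

lemma finite_orbit_periodic:
  assumes "finite (range (\<lambda>n. (neg_gauss ^^ n) x))"
  obtains m k where "(neg_gauss ^^ (m + Suc k)) x = (neg_gauss ^^ m) x"
proof -
  have "\<not> inj (\<lambda>n. (neg_gauss ^^ n) x)"
    using assms finite_imageD infinite_UNIV_nat by blast
  then obtain i j where ij: "i \<noteq> j" "(neg_gauss ^^ i) x = (neg_gauss ^^ j) x"
    unfolding inj_def by blast
  show thesis
  proof (cases "i < j")
    case True
    then obtain k where "j = i + Suc k" using less_imp_Suc_add by fastforce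
    then show thesis using ij that[of i k] by simp
  next
    case False
    then obtain k where "i = j + Suc k" using ij less_imp_Suc_add by (metis add_Suc_right nat_neq_iff)
    then show thesis using ij that[of j k] by simp
  qed
qed

text \<open>The shift sends \<open>a / b\<close> to \<open>b / d\<close> with \<open>0 < d \<le> b\<close>, so that neither numerators nor denominators
  ever grow.\<close>

lemma rational_finite_orbit:
  assumes x: "x \<ge> 1" "x \<in> \<rat>"
  shows "finite (range (\<lambda>n. (neg_gauss ^^ n) x))"
proof -
  obtain u v :: int where v: "v > 0" and xuv: "x = of_int u / of_int v"
    using x(2) by (rule Rats_cases') blast
  have uv: "v \<le> u" using x(1) v by (simp add: xuv le_divide_eq)
  have "\<exists>a b. 0 \<le> a \<and> a \<le> u \<and> 0 < b \<and> b \<le> v \<and> (neg_gauss ^^ n) x = of_int a / of_int b" for n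
  proof (induction n)
    case 0
    show ?case using v uv xuv by (intro exI[of _ u] exI[of _ v]) simp
  next
    case (Suc n)
    then obtain a b where ab: "0 \<le> a" "a \<le> u" "0 < b" "b \<le> v"
      and eq: "(neg_gauss ^^ n) x = of_int a / of_int b" by blast
    define d where "d = (\<lfloor>(neg_gauss ^^ n) x\<rfloor> + 1) * b - a"
    have d: "real_of_int d = (of_int \<lfloor>(neg_gauss ^^ n) x\<rfloor> + 1 - (neg_gauss ^^ n) x) * of_int b"
      using ab(3) by (simp add: d_def eq field_simps)
    have "0 < of_int \<lfloor>(neg_gauss ^^ n) x\<rfloor> + 1 - (neg_gauss ^^ n) x"
         "of_int \<lfloor>(neg_gauss ^^ n) x\<rfloor> + 1 - (neg_gauss ^^ n) x \<le> 1"
      by linarith+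
    then have "0 < real_of_int d" "real_of_int d \<le> of_int b"
      unfolding d using ab(3) by (auto intro: mult_left_le_one_le)
    then have "0 < d" "d \<le> b" by simp_all
    moreover have "(neg_gauss ^^ Suc n) x = of_int b / of_int d"
      unfolding d using ab(3) by (simp add: neg_gauss_def)
    ultimately show ?case using ab uv by (intro exI[of _ b] exI[of _ d]) simp
  qed
  then have "range (\<lambda>n. (neg_gauss ^^ n) x) \<subseteq>
      (\<lambda>(a, b). of_int a / of_int b) ` ({0..u} \<times> {0..v})"
    by (fastforce simp: image_iff)
  then show ?thesis by (rule finite_subset) auto
qed

text \<open>The two roots of an integral quadratic polynomial of discriminant \<open>D\<close>, recorded through the sum
  and the product of the roots.\<close>

definition conjugate_roots :: "int \<Rightarrow> real \<Rightarrow> real \<Rightarrow> bool" where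
  "conjugate_roots D x x' \<longleftrightarrow>
     (\<exists>a b c :: int. a \<noteq> 0 \<and> b^2 - 4 * a * c = D \<and>
        of_int b = - (of_int a * (x + x')) \<and> of_int c = of_int a * (x * x'))"

lemma conjugate_roots_irrational:
  assumes "conjugate_roots D x x'" "x \<notin> \<rat>"
  shows "x' \<notin> \<rat>" "x \<noteq> x'"
proof -
  obtain a b :: int where a: "a \<noteq> 0" and sum: "of_int b = - (of_int a * (x + x'))"
    using assms(1) unfolding conjugate_roots_def by blast
  have eq: "x = - of_int b / of_int a - x'"
    using a sum by (simp add: field_simps)
  show "x' \<notin> \<rat>"
    using assms(2) by (subst (asm) eq) auto
  show "x \<noteq> x'"
  proof
    assume "x = x'"
    then have "x = - of_int b / (2 * of_int a)" using eq by simp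
    then have "x \<in> \<rat>" by (simp only:) simp
    then show False using assms(2) by simp
  qed
qed

text \<open>If \<open>f\<close> is the polynomial with roots \<open>x\<close> and \<open>x'\<close> and leading coefficient \<open>a\<close>, then the new roots are
  those of \<open>f(k) t\<^sup>2 - f'(k) t + a\<close>, which has the same discriminant.\<close>

lemma conjugate_roots_step:
  assumes "conjugate_roots D x x'" "x \<noteq> of_int k" "x' \<noteq> of_int k"
  shows "conjugate_roots D (1 / (of_int k - x)) (1 / (of_int k - x'))"
proof -
  obtain a b c :: int where a: "a \<noteq> 0" and D: "b^2 - 4 * a * c = D"
    and sum: "of_int b = - (of_int a * (x + x'))" and prod: "of_int c = of_int a * (x * x')"
    using assms(1) unfolding conjugate_roots_def by blast
  define p p' where "p = of_int k - x" and "p' = of_int k - x'"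
  have p: "p \<noteq> 0" "p' \<noteq> 0" using assms by (auto simp: p_def p'_def)
  define a' where "a' = a * k^2 + b * k + c"
  define b' where "b' = - (2 * a * k + b)"
  have a': "real_of_int a' = of_int a * (p * p')"
    unfolding a'_def p_def p'_def by (simp add: sum prod algebra_simps power2_eq_square)
  have b': "real_of_int b' = - (of_int a * (p + p'))"
    unfolding b'_def p_def p'_def by (simp add: sum algebra_simps)
  show ?thesis
    unfolding conjugate_roots_def p_def[symmetric] p'_def[symmetric]
  proof (intro exI conjI)
    have "real_of_int a' \<noteq> 0" unfolding a' using a p by simp
    then show "a' \<noteq> 0" by simp
    show "b'^2 - 4 * a' * a = D"
      unfolding a'_def b'_def D[symmetric] by (simp add: algebra_simps power2_eq_square)
    show "real_of_int b' = - (of_int a' * (1 / p + 1 / p'))"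
      unfolding a' b' using p by (simp add: field_simps)
    show "real_of_int a = of_int a' * (1 / p * (1 / p'))"
      unfolding a' using p by simp
  qed
qed

text \<open>Shifted by 1, the polynomial \<open>a t\<^sup>2 + b t + c\<close> becomes \<open>a t\<^sup>2 + (2 a + b) t + s\<close> with \<open>s = a + b + c\<close>, and
  \<open>a s < 0\<close> because 1 separates the roots.  In \<open>D = (2 a + b)\<^sup>2 - 4 a s\<close> both terms are then nonnegative,
  so that \<open>D\<close> bounds the coefficients.\<close>

lemma finite_reduced_roots:
  "finite {x. x > 1 \<and> (\<exists>x' < 1. conjugate_roots D x x')}" (is "finite ?S")
proof -
  define box where "box = {- 4 * D..4 * D}"
  define roots where "roots = (\<lambda>(a, b, c). {x :: real. poly [:of_int c, of_int b, of_int a :: real:] x = 0})"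
  have sub: "?S \<subseteq> (\<Union>t \<in> {t \<in> box \<times> box \<times> box. fst t \<noteq> 0}. roots t)"
  proof
    fix x assume "x \<in> ?S"
    then obtain x' where x: "x > 1" "x' < 1" "conjugate_roots D x x'" by blast
    then obtain a b c :: int where a: "a \<noteq> 0" and D: "b^2 - 4 * a * c = D"
      and sum: "of_int b = - (of_int a * (x + x'))" and prod: "of_int c = of_int a * (x * x')"
      unfolding conjugate_roots_def by blast
    define s where "s = a + b + c"
    have "real_of_int (a * s) = (of_int a)^2 * ((1 - x) * (1 - x'))"
      unfolding s_def by (simp add: sum prod algebra_simps power2_eq_square)
    also have "\<dots> < 0" using a x by (intro mult_pos_neg mult_neg_pos) auto
    finally have neg: "a * s < 0" by (simp only: of_int_less_0_iff)
    have disc: "(2 * a + b)^2 + 4 * (\<bar>a\<bar> * \<bar>s\<bar>) = D"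
    proof -
      have "\<bar>a\<bar> * \<bar>s\<bar> = - (a * s)" using neg by (simp add: abs_mult[symmetric])
      then show ?thesis
        unfolding D[symmetric] s_def by (simp add: algebra_simps power2_eq_square)
    qed
    have "s \<noteq> 0" using neg by auto
    then have "\<bar>a\<bar> * 1 \<le> \<bar>a\<bar> * \<bar>s\<bar>" "1 * \<bar>s\<bar> \<le> \<bar>a\<bar> * \<bar>s\<bar>"
      using a by (intro mult_left_mono mult_right_mono; linarith)+
    then have as: "\<bar>a\<bar> \<le> \<bar>a\<bar> * \<bar>s\<bar>" "\<bar>s\<bar> \<le> \<bar>a\<bar> * \<bar>s\<bar>" by simp_all
    have sq: "\<bar>2 * a + b\<bar> \<le> (2 * a + b)^2"
      using self_le_power[of "\<bar>2 * a + b\<bar>" 2] by (cases "2 * a + b = 0") simp_all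
    \<comment> \<open>The abstract form keeps linear arithmetic from splitting the absolute values.\<close>
    have bound: "u \<le> D \<and> v \<le> D \<and> w \<le> D"
      if "0 \<le> u" "u \<le> m" "v \<le> m" "w \<le> r" "0 \<le> r" "r + 4 * m = D" for u v w m r :: int
      using that by linarith
    have "\<bar>a\<bar> \<le> D \<and> \<bar>s\<bar> \<le> D \<and> \<bar>2 * a + b\<bar> \<le> D"
      using bound[OF abs_ge_zero as sq zero_le_power2 disc] .
    then have "a \<in> box" "b \<in> box" "c \<in> box"
      unfolding box_def s_def abs_le_iff by auto
    moreover have "x \<in> roots (a, b, c)"
      unfolding roots_def by (simp add: sum prod algebra_simps)
    ultimately show "x \<in> (\<Union>t \<in> {t \<in> box \<times> box \<times> box. fst t \<noteq> 0}. roots t)"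
      using a by force
  qed
  have fin_roots: "finite (roots t)" if "fst t \<noteq> 0" for t
  proof -
    obtain a b c where t: "t = (a, b, c)" by (cases t)
    then have "[:of_int c, of_int b, of_int a :: real:] \<noteq> 0" using that by simp
    from poly_roots_finite[OF this] show ?thesis by (simp add: roots_def t)
  qed
  have fin_box: "finite {t \<in> box \<times> box \<times> box. fst t \<noteq> 0}"
    by (rule finite_subset[of _ "box \<times> box \<times> box"]) (auto simp: box_def)
  show ?thesis
    by (rule finite_subset[OF sub], rule finite_UN_I[OF fin_box]) (simp add: fin_roots)
qed

lemma orbit_irrational:
  assumes "x \<notin> \<rat>" shows "(neg_gauss ^^ n) x \<notin> \<rat>"
proof (induction n)
  case (Suc n)
  define y where "y = (neg_gauss ^^ n) x"
  have "y = of_int \<lfloor>y\<rfloor> + 1 - 1 / neg_gauss y" unfolding neg_gauss_def by simp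
  moreover have "of_int \<lfloor>y\<rfloor> + 1 - 1 / neg_gauss y \<in> \<rat>" if "neg_gauss y \<in> \<rat>"
    using that by auto
  ultimately have "neg_gauss y \<notin> \<rat>" using Suc.IH unfolding y_def[symmetric] by metis
  then show ?case by (simp add: y_def)
qed (use assms in simp)

lemma neg_gauss_conjugate_roots:
  assumes "conjugate_roots D y z" "y \<notin> \<rat>"
  shows "conjugate_roots D (neg_gauss y) (1 / (of_int \<lfloor>y\<rfloor> + 1 - z))"
proof -
  have "z \<notin> \<rat>" using conjugate_roots_irrational assms by blast
  then have "y \<noteq> of_int (\<lfloor>y\<rfloor> + 1)" "z \<noteq> of_int (\<lfloor>y\<rfloor> + 1)"
    using assms(2) Rats_of_int by metis+
  then show ?thesis
    using conjugate_roots_step[OF assms(1), of "\<lfloor>y\<rfloor> + 1"] by (simp add: neg_gauss_def)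
qed

text \<open>As long as \<open>x\<close> and its conjugate lie between the same consecutive integers, the shift acts on both
  of them.  This cannot go on forever, for the two numbers would have the same expansion.  As
  soon as an integer separates them, the shift of \<open>x\<close> is paired with a conjugate below 1.\<close>

lemma orbit_becomes_reduced:
  assumes x: "x \<ge> 1" "x \<notin> \<rat>" "conjugate_roots D x x'"
  shows "\<exists>n. \<exists>z < 1. conjugate_roots D ((neg_gauss ^^ n) x) z"
proof (rule ccontr)
  assume "\<not> ?thesis"
  then have ge1: "z \<ge> 1" if "conjugate_roots D ((neg_gauss ^^ n) x) z" for n z
    using that by (meson not_less)
  have same: "\<lfloor>y\<rfloor> = \<lfloor>z\<rfloor>"
    if y: "y = (neg_gauss ^^ n) x" and yz: "conjugate_roots D y z" for n y z
  proof -
    have "y \<notin> \<rat>" unfolding y using orbit_irrational x(2) .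
    from neg_gauss_conjugate_roots[OF yz this]
    have "1 \<le> 1 / (of_int \<lfloor>y\<rfloor> + 1 - z)"
      using ge1[of "Suc n"] y by simp
    then have "0 < of_int \<lfloor>y\<rfloor> + 1 - z" "of_int \<lfloor>y\<rfloor> + 1 - z \<le> 1"
      by (auto simp: le_divide_eq split: if_splits)
    then show ?thesis by (intro floor_unique[symmetric]) linarith+
  qed
  have conj: "conjugate_roots D ((neg_gauss ^^ n) x) ((neg_gauss ^^ n) x')" for n
  proof (induction n)
    case (Suc n)
    have "neg_gauss ((neg_gauss ^^ n) x') = 1 / (of_int \<lfloor>(neg_gauss ^^ n) x\<rfloor> + 1 - (neg_gauss ^^ n) x')"
      by (simp only: same[OF refl Suc] neg_gauss_def[of "(neg_gauss ^^ n) x'"])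
    then show ?case
      using neg_gauss_conjugate_roots[OF Suc orbit_irrational[OF x(2)]] by simp
  qed (use x(3) in simp)
  have "digit x = digit x'"
    by (rule ext) (simp add: digit_def same[OF refl conj])
  then have "x = x'" using digit_inject x(1) ge1[of 0 x'] x(3) by simp
  then show False using conjugate_roots_irrational(2)[OF x(3,2)] by simp
qed

text \<open>Once the conjugate \<open>z\<close> of \<open>y\<close> is below 1, it stays there: \<open>\<lfloor>y\<rfloor> + 1 - z > 1\<close>, so the next
  conjugate is the reciprocal of a number greater than 1.\<close>

lemma quadratic_finite_orbit:
  assumes x: "x \<ge> 1" "x \<notin> \<rat>" and quad: "quadratic_over \<int> x"
  shows "finite (range (\<lambda>n. (neg_gauss ^^ n) x))"
proof -
  obtain a b c :: int where a: "a \<noteq> 0" and root: "of_int a * x^2 + of_int b * x + of_int c = 0"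
    using quad irrational_quadratic_iff[OF x(2)] by blast
  define D where "D = b^2 - 4 * a * c"
  define x' where "x' = - of_int b / of_int a - x"
  have "conjugate_roots D x x'"
    unfolding conjugate_roots_def
  proof (intro exI conjI)
    show "real_of_int b = - (of_int a * (x + x'))" using a by (simp add: x'_def)
    show "real_of_int c = of_int a * (x * x')"
      using a root by (simp add: x'_def algebra_simps power2_eq_square)
  qed (use a in \<open>auto simp: D_def\<close>)
  then obtain m z where m: "conjugate_roots D ((neg_gauss ^^ m) x) z" "z < 1"
    using orbit_becomes_reduced x by blast
  have red: "\<exists>z < 1. conjugate_roots D ((neg_gauss ^^ (m + i)) x) z" for i
  proof (induction i)
    case (Suc i)
    define y where "y = (neg_gauss ^^ (m + i)) x"
    from Suc obtain z where z: "z < 1" "conjugate_roots D y z" unfolding y_def by blast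
    have "1 \<le> y" unfolding y_def using orbit_ge_1 x(1) .
    then have "1 \<le> \<lfloor>y\<rfloor>" by (simp add: le_floor_iff)
    then have "1 < of_int \<lfloor>y\<rfloor> + 1 - z" using z(1) by linarith
    then have "1 / (of_int \<lfloor>y\<rfloor> + 1 - z) < 1" by simp
    then show ?case
      using neg_gauss_conjugate_roots[OF z(2)] orbit_irrational[OF x(2)] by (auto simp: y_def)
  qed (use m in auto)
  have "(neg_gauss ^^ n) x \<in> (\<lambda>i. (neg_gauss ^^ i) x) ` {..<m} \<union>
      {x. x > 1 \<and> (\<exists>x' < 1. conjugate_roots D x x')}" for n
  proof (cases "n < m")
    case False
    have "(neg_gauss ^^ n) x \<noteq> 1" using orbit_irrational[OF x(2), of n] by auto
    then have "(neg_gauss ^^ n) x > 1" using orbit_ge_1[OF x(1), of n] by simp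
    then show ?thesis using red[of "n - m"] False by simp
  qed auto
  then have "range (\<lambda>n. (neg_gauss ^^ n) x) \<subseteq> (\<lambda>i. (neg_gauss ^^ i) x) ` {..<m} \<union>
      {x. x > 1 \<and> (\<exists>x' < 1. conjugate_roots D x x')}" by blast
  then show ?thesis by (rule finite_subset) (simp add: finite_reduced_roots)
qed

section \<open>The q-deformed continued fraction\<close>

lemma q_nat_eq_sum: "q_nat n = (\<Sum>i<n. fps_X ^ i)"
proof -
  have "q_nat n * (1 - fps_X) = (\<Sum>i<n. fps_X ^ i) * (1 - fps_X)"
    unfolding q_nat_def
    by (subst quot_fps_mult_cancel) (simp_all add: one_diff_power_eq mult.commute)
  moreover have "(1 - fps_X :: int fps) \<noteq> 0"
    by (metis eq_iff_diff_eq_0 fps_X_neq_one)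
  ultimately show ?thesis by simp
qed

lemma q_nat_nth: "fps_nth (q_nat n) i = (if i < n then 1 else 0)"
  by (simp add: q_nat_eq_sum fps_sum_nth)

lemma q_neg_cf_Cons:
  "cs \<noteq> [] \<Longrightarrow> q_neg_cf e (c # cs) = q_nat c - quot_fps (fps_X ^ (c - 1)) (q_neg_cf e cs)"
  by (cases cs) simp_all

lemma q_neg_cf_nth_0:
  assumes "cs \<noteq> []" "\<forall>c \<in> set cs. c \<ge> 2"
  shows "fps_nth (q_neg_cf q_nat cs) 0 = 1"
proof (cases cs)
  case (Cons c ds)
  then show ?thesis
    using assms
    by (cases "ds = []") (auto simp: q_neg_cf_Cons q_nat_nth quot_fps_def)
qed (use assms in simp)

lemma quot_fps_diff:
  assumes "fps_nth f 0 = 1" "fps_nth g 0 = 1"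
  shows "quot_fps h f - quot_fps h g = h * (fps_right_inverse f 1 * fps_right_inverse g 1 * (g - f))"
proof -
  have inv: "f * fps_right_inverse f 1 = 1" "g * fps_right_inverse g 1 = 1"
    using assms by (simp_all add: fps_right_inverse)
  have "fps_right_inverse f 1 * fps_right_inverse g 1 * (g - f) =
      fps_right_inverse f 1 * (g * fps_right_inverse g 1) -
      fps_right_inverse g 1 * (f * fps_right_inverse f 1)"
    by (simp only: algebra_simps)
  also have "\<dots> = fps_right_inverse f 1 - fps_right_inverse g 1"
    by (simp only: inv mult_1_right)
  finally show ?thesis by (simp only: quot_fps_def right_diff_distrib)
qed

definition q_convergent :: "(nat \<Rightarrow> nat) \<Rightarrow> nat \<Rightarrow> int fps" where
  "q_convergent c N = q_neg_cf q_nat (map c [0..<Suc N])"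

lemma q_convergent_0: "q_convergent c 0 = q_nat (c 0)"
  by (simp add: q_convergent_def)

lemma q_convergent_Suc:
  "q_convergent c (Suc N) =
     q_nat (c 0) - quot_fps (fps_X ^ (c 0 - 1)) (q_convergent (\<lambda>j. c (Suc j)) N)"
  unfolding q_convergent_def by (subst map_upt_Suc) (simp add: q_neg_cf_Cons del: upt_Suc)

lemma q_convergent_nth_0: "(\<And>j. c j \<ge> 2) \<Longrightarrow> fps_nth (q_convergent c N) 0 = 1"
  unfolding q_convergent_def by (rule q_neg_cf_nth_0) auto

lemma fps_X_power_dvd_iff: "fps_X ^ k dvd (f :: 'a :: comm_ring_1 fps) \<longleftrightarrow> (\<forall>i<k. fps_nth f i = 0)"
proof
  assume "\<forall>i<k. fps_nth f i = 0"
  then have "f = fps_X ^ k * fps_shift k f"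
    by (simp add: fps_eq_iff fps_X_power_mult_nth)
  then show "fps_X ^ k dvd f" by (metis dvd_triv_left)
qed (auto simp: dvd_def fps_X_power_mult_nth)

text \<open>The reciprocals of two tails that agree up to order \<open>N\<close> agree up to the same order, and the factor
  \<open>q\<^sup>c\<^sup>-\<^sup>1\<close> with \<open>c \<ge> 2\<close> gains at least one more order.\<close>

lemma q_convergent_stable:
  assumes "\<And>j. c j \<ge> 2"
  shows "fps_X ^ Suc N dvd q_convergent c (Suc N) - q_convergent c N"
  using assms
proof (induction N arbitrary: c)
  case 0
  have "fps_X ^ Suc 0 dvd (fps_X :: int fps) ^ (c 0 - 1)"
    using 0[of 0] by (intro le_imp_power_dvd) auto
  then have "fps_X ^ Suc 0 dvd fps_X ^ (c 0 - 1) * fps_right_inverse (q_nat (c (Suc 0))) 1"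
    by (rule dvd_mult2)
  then show ?case
    by (simp add: q_convergent_Suc q_convergent_0 quot_fps_def)
next
  case (Suc N)
  let ?c = "\<lambda>j. c (Suc j)"
  define I where "I = fps_right_inverse (q_convergent ?c N) 1 * fps_right_inverse (q_convergent ?c (Suc N)) 1"
  have "q_convergent c (Suc (Suc N)) - q_convergent c (Suc N) =
      quot_fps (fps_X ^ (c 0 - 1)) (q_convergent ?c N) -
      quot_fps (fps_X ^ (c 0 - 1)) (q_convergent ?c (Suc N))"
    by (simp add: q_convergent_Suc)
  also have "\<dots> = fps_X ^ (c 0 - 1) * (I * (q_convergent ?c (Suc N) - q_convergent ?c N))"
    unfolding I_def using Suc.prems by (intro quot_fps_diff q_convergent_nth_0) auto
  finally have eq: "q_convergent c (Suc (Suc N)) - q_convergent c (Suc N) =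
      fps_X ^ (c 0 - 1) * (I * (q_convergent ?c (Suc N) - q_convergent ?c N))" .
  have "fps_X ^ 1 dvd (fps_X :: int fps) ^ (c 0 - 1)"
    using Suc.prems[of 0] by (intro le_imp_power_dvd) auto
  moreover have "fps_X ^ Suc N dvd I * (q_convergent ?c (Suc N) - q_convergent ?c N)"
    using Suc.IH[of ?c] Suc.prems by (intro dvd_mult) auto
  ultimately have "fps_X ^ 1 * fps_X ^ Suc N dvd
      fps_X ^ (c 0 - 1) * (I * (q_convergent ?c (Suc N) - q_convergent ?c N))"
    by (rule mult_dvd_mono)
  then show ?case unfolding eq by simp
qed

definition q_limit :: "(nat \<Rightarrow> nat) \<Rightarrow> int fps" where
  "q_limit c = Abs_fps (\<lambda>n. fps_nth (q_convergent c n) n)"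

lemma q_convergent_nth:
  assumes "\<And>j. c j \<ge> 2" "n \<le> N"
  shows "fps_nth (q_convergent c N) n = fps_nth (q_limit c) n"
  using assms(2)
proof (induction N rule: dec_induct)
  case (step N)
  then show ?case
    using q_convergent_stable[OF assms(1), of N] unfolding fps_X_power_dvd_iff by simp
qed (simp add: q_limit_def)

lemma q_convergent_tendsto:
  assumes "\<And>j. c j \<ge> 2"
  shows "q_convergent c \<longlonglongrightarrow> q_limit c"
  unfolding tendsto_fps_iff eventually_sequentially
  using q_convergent_nth[of c] assms by blast

lemma q_limit_nth_0: "(\<And>j. c j \<ge> 2) \<Longrightarrow> fps_nth (q_limit c) 0 = 1"
  using q_convergent_nth[of c 0 0] q_convergent_nth_0[of c 0] by simp

text \<open>The identity holds for the convergents, and passing to the limits changes each side by a multiple of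
  \<open>q\<^sup>n\<^sup>+\<^sup>1\<close>, for every \<open>n\<close>.\<close>

lemma q_limit_recursion:
  assumes c: "\<And>j. c j \<ge> 2"
  shows "q_limit c * q_limit (\<lambda>j. c (Suc j)) =
           q_nat (c 0) * q_limit (\<lambda>j. c (Suc j)) - fps_X ^ (c 0 - 1)"
proof (rule fps_ext)
  fix n
  let ?c = "\<lambda>j. c (Suc j)"
  let ?A = "q_limit c" and ?B = "q_limit ?c"
  let ?a = "q_convergent c (Suc n)" and ?b = "q_convergent ?c n"
  have A: "fps_X ^ Suc n dvd ?A - ?a" and B: "fps_X ^ Suc n dvd ?B - ?b"
    using q_convergent_nth[of c] q_convergent_nth[of ?c] c unfolding fps_X_power_dvd_iff by auto
  have "?a * ?b = q_nat (c 0) * ?b - quot_fps (fps_X ^ (c 0 - 1)) ?b * ?b"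
    by (simp add: q_convergent_Suc algebra_simps)
  also have "quot_fps (fps_X ^ (c 0 - 1)) ?b * ?b = fps_X ^ (c 0 - 1)"
    using c by (intro quot_fps_mult_cancel q_convergent_nth_0)
  finally have ab: "?a * ?b = q_nat (c 0) * ?b - fps_X ^ (c 0 - 1)" .
  have "?A * ?B - (q_nat (c 0) * ?B - fps_X ^ (c 0 - 1)) =
      (?A - ?a) * ?B + (?a - q_nat (c 0)) * (?B - ?b)"
    using ab by (simp add: algebra_simps)
  then have "fps_X ^ Suc n dvd ?A * ?B - (q_nat (c 0) * ?B - fps_X ^ (c 0 - 1))"
    using A B by simp
  then show "fps_nth (?A * ?B) n = fps_nth (q_nat (c 0) * ?B - fps_X ^ (c 0 - 1)) n"
    unfolding fps_X_power_dvd_iff by simp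
qed

lemma q_real_eq_q_limit:
  assumes "x \<ge> 1"
  shows "q_real x = fps_to_fls (q_limit (digit x))"
proof -
  have "q_convergent (digit x) \<longlonglongrightarrow> q_limit (digit x)"
    by (rule q_convergent_tendsto) (rule digit_ge_2[OF assms])
  then have "lim (q_convergent (digit x)) = q_limit (digit x)" by (rule limI)
  then show ?thesis
    using assms by (subst q_real.simps) (simp add: neg_cf_expansion_eq_digit q_convergent_def[abs_def] del: upt_Suc)
qed

section \<open>Reduction to a field\<close>

definition reduce_fps :: "int fps \<Rightarrow> 'a :: comm_ring_1 fps" where
  "reduce_fps f = Abs_fps (\<lambda>n. of_int (fps_nth f n))"

lemma reduce_fps_nth [simp]: "fps_nth (reduce_fps f) n = of_int (fps_nth f n)"
  by (simp add: reduce_fps_def)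

lemma reduce_fps_hom [simp]:
  "reduce_fps (f + g) = reduce_fps f + reduce_fps g"
  "reduce_fps (f - g) = reduce_fps f - reduce_fps g"
  "reduce_fps (f * g) = reduce_fps f * reduce_fps g"
  "reduce_fps 0 = 0" "reduce_fps 1 = 1" "reduce_fps fps_X = fps_X"
  "reduce_fps (fps_const c) = fps_const (of_int c)"
  by (simp_all add: fps_eq_iff fps_mult_nth fps_X_def)

lemma reduce_fps_power [simp]: "reduce_fps (f ^ n) = reduce_fps f ^ n"
  by (induction n) simp_all

lemma reduce_fls_fps_to_fls: "reduce_fls (fps_to_fls f) = fps_to_fls (reduce_fps f)"
  by (intro fls_eqI) (simp add: reduce_fls_nth)

lemma reduce_fls_shift:
  "reduce_fls (fls_X_inv * (f - 1)) = fls_X_inv * (reduce_fls f - 1)"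
  by (intro fls_eqI) (simp add: reduce_fls_nth fls_X_inv_times_conv_shift)

text \<open>The reduction of \<open>[x]\<^sub>q\<close>, as a function of the continued fraction of \<open>x\<close>.\<close>

definition reduced_limit :: "(nat \<Rightarrow> nat) \<Rightarrow> 'a :: field fps" where
  "reduced_limit c = reduce_fps (q_limit c)"

definition q_nat_poly :: "nat \<Rightarrow> 'a :: field poly" where
  "q_nat_poly n = (\<Sum>i<n. Polynomial.monom 1 i)"

lemma coeff_q_nat_poly: "Polynomial.coeff (q_nat_poly n) i = (if i < n then 1 else 0)"
  by (simp add: q_nat_poly_def coeff_sum)

lemma reduce_q_nat: "reduce_fps (q_nat n) = fps_of_poly (q_nat_poly n)"
  by (simp add: fps_eq_iff coeff_q_nat_poly q_nat_nth)

lemma reduced_limit_nth_0: "(\<And>j. c j \<ge> 2) \<Longrightarrow> fps_nth (reduced_limit c) 0 = 1"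
  by (simp add: reduced_limit_def q_limit_nth_0)

lemma reduced_limit_recursion:
  assumes "\<And>j. c j \<ge> 2"
  shows "(reduced_limit c :: 'a :: field fps) * reduced_limit (\<lambda>j. c (Suc j)) =
           fps_of_poly (q_nat_poly (c 0)) * reduced_limit (\<lambda>j. c (Suc j)) - fps_X ^ (c 0 - 1)"
proof -
  have "(reduce_fps (q_limit c * q_limit (\<lambda>j. c (Suc j))) :: 'a fps) =
      reduce_fps (q_nat (c 0) * q_limit (\<lambda>j. c (Suc j)) - fps_X ^ (c 0 - 1))"
    using assms by (simp only: q_limit_recursion)
  then show ?thesis by (simp add: reduced_limit_def reduce_q_nat)
qed

text \<open>Since \<open>g = [c]\<^sub>q - q\<^sup>c\<^sup>-\<^sup>1 / h\<close> and \<open>h\<close> has constant coefficient 1, the last term of \<open>[c]\<^sub>q\<close> cancels: the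
  series \<open>g\<close> starts with \<open>c - 1\<close> coefficients 1 followed by a coefficient 0.  Over any field this
  pattern reveals \<open>c\<close>, so reduction loses no information about the expansion.\<close>

lemma reduced_limit_nth:
  assumes c: "\<And>j. c j \<ge> 2"
  shows "i < c 0 - 1 \<Longrightarrow> fps_nth (reduced_limit c :: 'a :: field fps) i = 1"
    and "fps_nth (reduced_limit c :: 'a fps) (c 0 - 1) = 0"
proof -
  let ?g = "reduced_limit c :: 'a fps" and ?h = "reduced_limit (\<lambda>j. c (Suc j)) :: 'a fps"
  have h: "fps_nth ?h 0 = 1" using c by (intro reduced_limit_nth_0)
  then have "?h * inverse ?h = 1" by (simp add: inverse_mult_eq_1')
  moreover have "(?g - fps_of_poly (q_nat_poly (c 0))) * ?h = - (fps_X ^ (c 0 - 1))"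
    using reduced_limit_recursion[of c] c by (simp add: algebra_simps)
  ultimately have "?g - fps_of_poly (q_nat_poly (c 0)) = - (fps_X ^ (c 0 - 1)) * inverse ?h"
    by (metis mult.assoc mult_1_right)
  then have g: "?g = fps_of_poly (q_nat_poly (c 0)) - fps_X ^ (c 0 - 1) * inverse ?h"
    by (simp add: algebra_simps)
  show "fps_nth ?g i = 1" if "i < c 0 - 1"
    using that by (subst g) (simp add: fps_X_power_mult_nth coeff_q_nat_poly)
  show "fps_nth ?g (c 0 - 1) = 0"
    using h c[of 0] by (subst g) (simp add: fps_X_power_mult_nth coeff_q_nat_poly)
qed

lemma reduced_limit_determines_head:
  assumes c: "\<And>j. c j \<ge> 2" and d: "\<And>j. d j \<ge> 2"
    and eq: "(reduced_limit c :: 'a :: field fps) = reduced_limit d"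
  shows "c 0 = d 0"
    and "(reduced_limit (\<lambda>j. c (Suc j)) :: 'a fps) = reduced_limit (\<lambda>j. d (Suc j))"
proof -
  have less: False if c: "\<And>j. c j \<ge> 2" and d: "\<And>j. d j \<ge> 2"
    and eq: "(reduced_limit c :: 'a fps) = reduced_limit d" and "c 0 < d 0" for c d
  proof -
    have "c 0 - 1 < d 0 - 1" using c[of 0] \<open>c 0 < d 0\<close> by simp
    then have "fps_nth (reduced_limit d :: 'a fps) (c 0 - 1) = 1"
      by (rule reduced_limit_nth(1)[OF d])
    moreover have "fps_nth (reduced_limit c :: 'a fps) (c 0 - 1) = 0"
      by (rule reduced_limit_nth(2)[OF c])
    ultimately show False using eq by simp
  qed
  have "\<not> c 0 < d 0" "\<not> d 0 < c 0"
    using less[OF c d eq] less[OF d c eq[symmetric]] by blast+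
  then show head: "c 0 = d 0" by simp
  have "(reduced_limit c - fps_of_poly (q_nat_poly (c 0))) * reduced_limit (\<lambda>j. c (Suc j)) =
      (- (fps_X ^ (c 0 - 1)) :: 'a fps)"
    using reduced_limit_recursion[of c, where ?'a = 'a] c by (simp add: algebra_simps)
  moreover have "(reduced_limit c - fps_of_poly (q_nat_poly (c 0))) * reduced_limit (\<lambda>j. d (Suc j)) =
      (- (fps_X ^ (c 0 - 1)) :: 'a fps)"
    using reduced_limit_recursion[of d, where ?'a = 'a] d eq head by (simp add: algebra_simps)
  moreover from this have "(reduced_limit c - fps_of_poly (q_nat_poly (c 0)) :: 'a fps) \<noteq> 0"
    by auto
  ultimately show "(reduced_limit (\<lambda>j. c (Suc j)) :: 'a fps) = reduced_limit (\<lambda>j. d (Suc j))"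
    by (metis mult_left_cancel)
qed

lemma reduced_limit_inject:
  assumes "\<And>j. c j \<ge> 2" "\<And>j. d j \<ge> 2"
    and "(reduced_limit c :: 'a :: field fps) = reduced_limit d"
  shows "c = d"
proof
  show "c n = d n" for n using assms
  proof (induction n arbitrary: c d)
    case 0
    then show ?case using reduced_limit_determines_head(1) by blast
  next
    case (Suc n)
    then show ?case
      using reduced_limit_determines_head(2)[OF Suc.prems] by (intro Suc.IH) auto
  qed
qed

section \<open>The field of rational functions\<close>

abbreviation fls_of_poly :: "'a :: field poly \<Rightarrow> 'a fls" where
  "fls_of_poly p \<equiv> fps_to_fls (fps_of_poly p)"

lemma fps_of_poly_eq_0_iff: "fps_of_poly p = 0 \<longleftrightarrow> p = 0"
  using fps_of_poly_eq_iff[of p 0] by simp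

lemma fls_of_poly_hom:
  "fls_of_poly (p + q) = fls_of_poly p + fls_of_poly q"
  "fls_of_poly (- p) = - fls_of_poly p"
  "fls_of_poly (p * q) = fls_of_poly p * fls_of_poly q"
  "fls_of_poly p = 0 \<longleftrightarrow> p = 0"
  by (simp_all add: fps_of_poly_add fps_of_poly_uminus fps_of_poly_mult fls_times_fps_to_fls
      fps_of_poly_eq_0_iff)

lemma rational_functions_iff:
  "y \<in> rational_functions \<longleftrightarrow> (\<exists>a b. b \<noteq> 0 \<and> y * fls_of_poly b = fls_of_poly a)"
proof -
  have "y = fls_of_poly a / fls_of_poly b \<longleftrightarrow> y * fls_of_poly b = fls_of_poly a" if "b \<noteq> 0" for a b
    using that by (simp add: eq_divide_eq fls_of_poly_hom)
  then show ?thesis unfolding rational_functions_def by blast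
qed

interpretation rational_functions: coefficient_ring "rational_functions :: 'a :: field fls set"
proof
  show "(1 :: 'a fls) \<in> rational_functions"
    unfolding rational_functions_iff by (rule exI[of _ 1], rule exI[of _ 1]) simp
next
  fix y z :: "'a fls" assume "y \<in> rational_functions" "z \<in> rational_functions"
  then obtain a b c d where b: "b \<noteq> 0" and d: "d \<noteq> 0"
    and y: "y * fls_of_poly b = fls_of_poly a" and z: "z * fls_of_poly d = fls_of_poly c"
    unfolding rational_functions_iff by blast
  have "(y + z) * fls_of_poly (b * d) =
      (y * fls_of_poly b) * fls_of_poly d + (z * fls_of_poly d) * fls_of_poly b"
    by (simp add: fls_of_poly_hom algebra_simps)
  also have "\<dots> = fls_of_poly (a * d + c * b)" unfolding y z by (simp add: fls_of_poly_hom)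
  finally show "y + z \<in> rational_functions"
    unfolding rational_functions_iff using b d by (metis no_zero_divisors)
  have "(y * z) * fls_of_poly (b * d) = (y * fls_of_poly b) * (z * fls_of_poly d)"
    by (simp add: fls_of_poly_hom algebra_simps)
  also have "\<dots> = fls_of_poly (a * c)" unfolding y z by (simp add: fls_of_poly_hom)
  finally show "y * z \<in> rational_functions"
    unfolding rational_functions_iff using b d by (metis no_zero_divisors)
next
  fix y :: "'a fls" assume "y \<in> rational_functions"
  then obtain a b where b: "b \<noteq> 0" and y: "y * fls_of_poly b = fls_of_poly a"
    unfolding rational_functions_iff by blast
  have "(- y) * fls_of_poly b = fls_of_poly (- a)" using y by (simp add: fls_of_poly_hom)
  then show "- y \<in> rational_functions" unfolding rational_functions_iff using b by blast
qed

lemma inverse_rational_function: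
  assumes "y \<in> rational_functions"
  shows "inverse y \<in> rational_functions"
proof (cases "y = 0")
  case False
  obtain a b where b: "b \<noteq> 0" and y: "y * fls_of_poly b = fls_of_poly a"
    using assms unfolding rational_functions_iff by blast
  have "fls_of_poly a \<noteq> 0" unfolding y[symmetric] using False b by (simp add: fls_of_poly_hom)
  moreover from this have "a \<noteq> 0" by (simp add: fls_of_poly_hom)
  moreover have "inverse y * fls_of_poly a = fls_of_poly b"
    unfolding y[symmetric] using False by simp
  ultimately show ?thesis unfolding rational_functions_iff by blast
qed (use assms in simp)

lemma fls_of_poly_rational: "fls_of_poly p \<in> rational_functions"
  unfolding rational_functions_iff by (rule exI[of _ p], rule exI[of _ 1]) simp

lemma fls_X_rational: "fls_X \<in> rational_functions"
  using fls_of_poly_rational[of "[:0, 1:]"] by (simp only: fps_of_poly_fps_X fps_X_to_fls)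

lemma fls_X_inv_rational: "fls_X_inv \<in> rational_functions"
  using inverse_rational_function[OF fls_X_rational] by (simp add: fls_inverse_X)

lemma fls_X_mult_X_inv: "fls_X * fls_X_inv = (1 :: 'a :: field fls)"
  using right_inverse[of "fls_X :: 'a fls"] by (simp add: fls_inverse_X)

section \<open>Rationality of the left q-rational numbers\<close>

text \<open>The recursion for \<open>fps_right_inverse g 1\<close> reads only the coefficients of \<open>g\<close> of positive index, so the
  quotient is always taken by \<open>g\<close> with its constant coefficient replaced by 1.  That denominator stays
  nonzero in every field.\<close>

lemma quot_fps_normalized:
  "quot_fps f g * (g - fps_const (fps_nth g 0) + 1) = f"
proof -
  have cong: "fps_right_inverse_constructor g 1 n =
      fps_right_inverse_constructor (g - fps_const (fps_nth g 0) + 1) 1 n" for n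
  proof (induction n rule: less_induct)
    case (less n)
    show ?case
    proof (cases "n > 0")
      case True
      have "(\<Sum>i=1..n. fps_nth g i * fps_right_inverse_constructor g 1 (n - i)) =
          (\<Sum>i=1..n. fps_nth (g - fps_const (fps_nth g 0) + 1) i *
            fps_right_inverse_constructor (g - fps_const (fps_nth g 0) + 1) 1 (n - i))"
        by (rule sum.cong) (auto simp: less)
      then show ?thesis using True by (simp only: fps_right_inverse_constructor_rec)
    qed simp
  qed
  have "quot_fps f g = quot_fps f (g - fps_const (fps_nth g 0) + 1)"
    unfolding quot_fps_def by (simp only: cong[abs_def])
  then show ?thesis by (simp add: quot_fps_mult_cancel)
qed

text \<open>The type argument fixes the field in which the integer coefficients are read.\<close>

definition rational_reduction :: "'a :: field itself \<Rightarrow> int fps \<Rightarrow> bool" where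
  "rational_reduction _ f \<longleftrightarrow> fps_to_fls (reduce_fps f :: 'a fps) \<in> rational_functions"

lemma rational_reduction_ring:
  assumes "rational_reduction TYPE('a :: field) f" "rational_reduction TYPE('a) g"
  shows "rational_reduction TYPE('a) (f - g)" "rational_reduction TYPE('a) (f * g)"
    "rational_reduction TYPE('a) (quot_fps f g)"
proof -
  show "rational_reduction TYPE('a) (f - g)" "rational_reduction TYPE('a) (f * g)"
    using assms by (simp_all add: rational_reduction_def fls_times_fps_to_fls)
  define h where "h = g - fps_const (fps_nth g 0) + 1"
  have "fps_to_fls (fps_const (of_int (fps_nth g 0)) :: 'a fps) \<in> rational_functions"
    using fls_of_poly_rational[of "[:of_int (fps_nth g 0) :: 'a:]"] by (simp only: fps_of_poly_const)
  then have h: "fps_to_fls (reduce_fps h :: 'a fps) \<in> rational_functions"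
    unfolding h_def using assms(2) by (simp add: rational_reduction_def)
  have "fps_nth (reduce_fps h :: 'a fps) 0 = 1" by (simp add: h_def)
  then have nz: "fps_to_fls (reduce_fps h :: 'a fps) \<noteq> 0"
    by (metis fps_to_fls_eq_0_iff fps_zero_nth zero_neq_one)
  have "(reduce_fps (quot_fps f g * h) :: 'a fps) = reduce_fps f"
    unfolding h_def by (simp only: quot_fps_normalized)
  then have "fps_to_fls (reduce_fps (quot_fps f g) :: 'a fps) * fps_to_fls (reduce_fps h) =
      fps_to_fls (reduce_fps f)"
    by (simp flip: fls_times_fps_to_fls)
  then have "fps_to_fls (reduce_fps (quot_fps f g) :: 'a fps) =
      fps_to_fls (reduce_fps f) * inverse (fps_to_fls (reduce_fps h))"
    using nz by (metis divide_inverse nonzero_mult_div_cancel_right)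
  then show "rational_reduction TYPE('a) (quot_fps f g)"
    using assms(1) inverse_rational_function[OF h] by (simp add: rational_reduction_def)
qed

lemma rational_reduction_basic:
  "rational_reduction TYPE('a :: field) 0" "rational_reduction TYPE('a) 1"
  "rational_reduction TYPE('a) fps_X"
  by (simp_all add: rational_reduction_def fps_X_to_fls fls_X_rational)

lemma rational_reduction_power:
  "rational_reduction TYPE('a :: field) f \<Longrightarrow> rational_reduction TYPE('a) (f ^ n)"
  by (induction n) (simp_all add: rational_reduction_ring rational_reduction_basic)

lemma rational_reduction_q_neg_cf:
  assumes "\<And>c. rational_reduction TYPE('a :: field) (e c)"
  shows "rational_reduction TYPE('a) (q_neg_cf e cs)"
  using assms
proof (induction e cs rule: q_neg_cf.induct)
  case (3 e c d cs)
  then show ?case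
    by (auto simp: q_nat_def intro!: rational_reduction_ring rational_reduction_power rational_reduction_basic)
qed (auto simp: rational_reduction_basic)

lemma reduce_q_rat_minus_rational:
  "(reduce_fls (q_rat_minus r) :: 'a :: field fls) \<in> rational_functions"
proof (induction r rule: q_rat_minus.induct)
  case (1 r)
  show ?case
  proof (cases "r > 1")
    case True
    have "rational_reduction TYPE('a)
        (q_neg_cf (\<lambda>c. q_nat c - fps_X ^ (c - 1) * (1 - fps_X)) (finite_neg_cf_expansion r))"
      by (rule rational_reduction_q_neg_cf)
        (auto simp: q_nat_def intro!: rational_reduction_ring rational_reduction_power rational_reduction_basic)
    then show ?thesis
      using True by (subst q_rat_minus.simps) (simp add: rational_reduction_def reduce_fls_fps_to_fls)
  next
    case False
    then show ?thesis
      using 1 fls_X_inv_rational[where ?'a = 'a] by (subst q_rat_minus.simps) (simp add: reduce_fls_shift)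
  qed
qed

section \<open>Quadratic real numbers have quadratic q-analogues\<close>

lemma reduced_orbit_recursion:
  assumes "x \<ge> 1"
  shows "reduced_limit (digit ((neg_gauss ^^ j) x)) * reduced_limit (digit ((neg_gauss ^^ Suc j) x)) =
      fps_of_poly (q_nat_poly (digit x j)) * reduced_limit (digit ((neg_gauss ^^ Suc j) x)) -
      (fps_X ^ (digit x j - 1) :: 'a :: field fps)"
proof -
  have "(\<lambda>i. digit ((neg_gauss ^^ j) x) (Suc i)) = digit ((neg_gauss ^^ Suc j) x)"
    by (rule ext) (simp add: digit_Suc)
  moreover have "digit ((neg_gauss ^^ j) x) 0 = digit x j" by (simp add: digit_def)
  ultimately show ?thesis
    using reduced_limit_recursion[of "digit ((neg_gauss ^^ j) x)", where ?'a = 'a]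
      digit_ge_2[OF orbit_ge_1[OF assms]] by simp
qed

text \<open>At \<open>q = 0\<close> every matrix with rows \<open>([c]\<^sub>q, - q\<^sup>c\<^sup>-\<^sup>1)\<close> and \<open>(1, 0)\<close>, where \<open>c \<ge> 2\<close>, becomes the matrix with
  both rows \<open>(1, 0)\<close>, and so does every product of them.  Hence the lower left entry \<open>R\<close> of the
  product has constant coefficient 1.\<close>

lemma periodic_orbit_reduction_quadratic:
  assumes x: "x \<ge> 1" and per: "(neg_gauss ^^ (m + Suc k)) x = (neg_gauss ^^ m) x"
  shows "quadratic_over rational_functions (reduce_fls (q_real x) :: 'a :: field fls)"
proof -
  define \<alpha> where "\<alpha> j = (fps_to_fls (reduced_limit (digit ((neg_gauss ^^ j) x))) :: 'a fls)" for j
  define I where "I R S \<longleftrightarrow> (\<exists>r s :: 'a fps. R = fps_to_fls r \<and> S = fps_to_fls s \<and>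
      fps_nth r 0 = 1 \<and> fps_nth s 0 = 0)" for R S :: "'a fls"
  have "quadratic_over rational_functions (\<alpha> 0)"
  proof (rule rational_functions.eventually_periodic_quadratic[where
        u = "\<lambda>j. fls_of_poly (q_nat_poly (digit x j))" and v = "\<lambda>j. fls_X ^ (digit x j - 1)" and I = I])
    fix j
    show "\<alpha> j * \<alpha> (Suc j) = fls_of_poly (q_nat_poly (digit x j)) * \<alpha> (Suc j) - fls_X ^ (digit x j - 1)"
      unfolding \<alpha>_def fls_times_fps_to_fls[symmetric] reduced_orbit_recursion[OF x]
      by (simp add: fls_times_fps_to_fls fps_to_fls_power fps_X_to_fls)
    have "fps_nth (reduced_limit (digit ((neg_gauss ^^ j) x)) :: 'a fps) 0 = 1"
      by (intro reduced_limit_nth_0 digit_ge_2 orbit_ge_1 x)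
    then show "\<alpha> j \<noteq> 0"
      unfolding \<alpha>_def by (metis fps_to_fls_eq_0_iff fps_zero_nth zero_neq_one)
  next
    show "I 1 0" unfolding I_def by (rule exI[of _ 1], rule exI[of _ 0]) simp
  next
    fix R S j assume "I R S"
    then obtain r s where rs: "R = fps_to_fls r" "S = fps_to_fls s" "fps_nth r 0 = 1" "fps_nth s 0 = 0"
      unfolding I_def by blast
    have c: "digit x j \<ge> 2" using digit_ge_2[OF x] .
    show "I (R * fls_of_poly (q_nat_poly (digit x j)) + S) (- (R * fls_X ^ (digit x j - 1)))"
      unfolding I_def
      by (rule exI[of _ "r * fps_of_poly (q_nat_poly (digit x j)) + s"],
          rule exI[of _ "- (r * fps_X ^ (digit x j - 1))"])
        (use rs c in \<open>simp add: fls_times_fps_to_fls fps_to_fls_power fps_X_to_fls coeff_q_nat_poly\<close>)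
  next
    show "R \<noteq> 0" if "I R S" for R S
      using that unfolding I_def by (metis fps_to_fls_eq_0_iff fps_zero_nth zero_neq_one)
  next
    show "\<alpha> (m + Suc k) = \<alpha> m" unfolding \<alpha>_def per ..
  qed (simp_all add: fls_of_poly_rational fls_X_rational)
  moreover have "reduce_fls (q_real x) = \<alpha> 0"
    using x by (simp add: \<alpha>_def q_real_eq_q_limit reduce_fls_fps_to_fls reduced_limit_def)
  ultimately show ?thesis by simp
qed

lemma quadratic_reduction_quadratic:
  assumes "quadratic_over \<int> x"
  shows "quadratic_over rational_functions (reduce_fls (q_real x) :: 'a :: field fls)"
  using assms
proof (induction x rule: q_real.induct)
  case (1 x)
  show ?case
  proof (cases "x \<ge> 1")
    case True
    then have "finite (range (\<lambda>n. (neg_gauss ^^ n) x))"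
      using quadratic_finite_orbit rational_finite_orbit "1.prems" by blast
    then obtain m k where "(neg_gauss ^^ (m + Suc k)) x = (neg_gauss ^^ m) x"
      by (rule finite_orbit_periodic)
    then show ?thesis by (rule periodic_orbit_reduction_quadratic[OF True])
  next
    case False
    have "quadratic_over \<int> (1 * x + 1)"
      using "1.prems" by (intro Ints.quadratic_affine) simp_all
    then have "quadratic_over rational_functions
        (fls_X_inv * (reduce_fls (q_real (x + 1)) :: 'a fls) + - fls_X_inv)"
      using 1(1)[OF False] by (intro rational_functions.quadratic_affine) (simp_all add: fls_X_inv_rational)
    moreover have "reduce_fls (q_real x) = fls_X_inv * ((reduce_fls (q_real (x + 1)) :: 'a fls) - 1)"
      using False by (subst q_real.simps) (simp add: reduce_fls_shift)
    ultimately show ?thesis by (simp add: right_diff_distrib)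
  qed
qed

section \<open>Rational q-analogues force periodicity\<close>

lemma finite_polys_degree_le: "finite {p :: 'a :: {finite, field} poly. degree p \<le> n}"
proof (rule finite_subset)
  show "{p :: 'a poly. degree p \<le> n} \<subseteq> Poly ` {xs. set xs \<subseteq> UNIV \<and> length xs \<le> Suc n}"
  proof
    fix p :: "'a poly" assume "p \<in> {p. degree p \<le> n}"
    then have "length (coeffs p) \<le> Suc n" by (cases "p = 0") (simp_all add: length_coeffs_degree)
    then show "p \<in> Poly ` {xs. set xs \<subseteq> UNIV \<and> length xs \<le> Suc n}"
      by (intro image_eqI[of _ _ "coeffs p"]) simp_all
  qed
qed (intro finite_imageI finite_lists_length_le finite)

text \<open>One bound serves for numerator and denominator, since the shift turns the old denominator into the new
  numerator.\<close>

definition fraction_of_degree :: "nat \<Rightarrow> 'a :: field fps \<Rightarrow> bool" where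
  "fraction_of_degree n g \<longleftrightarrow>
     (\<exists>a b. b \<noteq> 0 \<and> degree a \<le> n \<and> degree b \<le> n \<and> g * fps_of_poly b = fps_of_poly a)"

lemma finite_fractions_of_degree:
  "finite {g :: 'a :: {finite, field} fps. fraction_of_degree n g}"
proof (rule finite_subset)
  show "{g :: 'a fps. fraction_of_degree n g} \<subseteq>
      (\<lambda>(a, b). fps_of_poly a / fps_of_poly b) ` ({a. degree a \<le> n} \<times> {b. degree b \<le> n})"
  proof
    fix g :: "'a fps" assume "g \<in> {g. fraction_of_degree n g}"
    then obtain a b where "b \<noteq> 0" "degree a \<le> n" "degree b \<le> n" "g * fps_of_poly b = fps_of_poly a"
      unfolding fraction_of_degree_def by blast
    moreover from this have "g = fps_of_poly a / fps_of_poly b"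
      by (metis fps_of_poly_eq_0_iff nonzero_mult_div_cancel_right)
    ultimately show "g \<in> (\<lambda>(a, b). fps_of_poly a / fps_of_poly b) ` ({a. degree a \<le> n} \<times> {b. degree b \<le> n})"
      by (intro image_eqI[of _ _ "(a, b)"]) simp_all
  qed
qed (intro finite_imageI finite_cartesian_product finite_polys_degree_le)

text \<open>If \<open>g = a / b\<close>, then \<open>h = q\<^sup>k\<^sup>-\<^sup>1 / ([k]\<^sub>q - g) = b / d\<close> with \<open>d = ([k]\<^sub>q b - a) / q\<^sup>k\<^sup>-\<^sup>1\<close>.  The division is exact
  because \<open>h\<close> is invertible, and it takes back the \<open>k - 1\<close> degrees that the factor \<open>[k]\<^sub>q\<close> added.\<close>

lemma fraction_of_degree_step:
  fixes g h :: "'a :: field fps"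
  assumes g: "fraction_of_degree n g" and h: "fps_nth h 0 = 1" and k: "k \<ge> 1"
    and rec: "g * h = fps_of_poly (q_nat_poly k) * h - fps_X ^ (k - 1)"
  shows "fraction_of_degree n h"
proof -
  obtain a b where b: "b \<noteq> 0" and deg: "degree a \<le> n" "degree b \<le> n"
    and gb: "g * fps_of_poly b = fps_of_poly a"
    using g unfolding fraction_of_degree_def by blast
  define c where "c = q_nat_poly k * b - a"
  have "fps_X ^ (k - 1) * fps_of_poly b = (fps_of_poly (q_nat_poly k) * h - g * h) * fps_of_poly b"
    by (simp add: rec)
  also have "\<dots> = (fps_of_poly (q_nat_poly k) * fps_of_poly b - g * fps_of_poly b) * h"
    by (simp add: algebra_simps)
  also have "\<dots> = fps_of_poly c * h"
    unfolding gb by (simp add: c_def fps_of_poly_diff fps_of_poly_mult)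
  finally have ch: "fps_of_poly c * h = fps_X ^ (k - 1) * fps_of_poly b" ..
  have "fps_of_poly c = fps_of_poly c * h * inverse h"
    using h by (simp add: mult.assoc inverse_mult_eq_1')
  also have "\<dots> = fps_X ^ (k - 1) * (fps_of_poly b * inverse h)" by (simp add: ch mult.assoc)
  finally have "fps_nth (fps_of_poly c) i = 0" if "i < k - 1" for i
    using that by (simp only: fps_X_power_mult_nth) simp
  then have "Polynomial.monom 1 (k - 1) dvd c" by (simp add: monom_1_dvd_iff')
  then obtain d where d: "c = Polynomial.monom 1 (k - 1) * d" by (auto elim: dvdE)
  have "fps_X ^ (k - 1) * (h * fps_of_poly d) = fps_X ^ (k - 1) * fps_of_poly b"
    using ch by (simp add: d fps_of_poly_mult fps_of_poly_monom' mult_ac)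
  then have hd: "h * fps_of_poly d = fps_of_poly b" by simp
  have "d \<noteq> 0" using hd b by auto
  have "degree d + (k - 1) = degree c"
    using \<open>d \<noteq> 0\<close> by (simp add: d degree_mult_eq degree_monom_eq)
  also have "degree (q_nat_poly k :: 'a poly) \<le> k - 1"
    by (rule degree_le) (auto simp: coeff_q_nat_poly)
  then have "degree (q_nat_poly k * b) \<le> n + (k - 1)"
    using degree_mult_le[of "q_nat_poly k" b] deg by simp
  then have "degree c \<le> n + (k - 1)"
    unfolding c_def using deg by (intro degree_diff_le) simp_all
  finally have "degree d \<le> n" by simp
  then show ?thesis
    unfolding fraction_of_degree_def using hd \<open>d \<noteq> 0\<close> deg by blast
qed

text \<open>Over a finite field there are only finitely many fractions of bounded degree, so the series attached
  to the orbit of \<open>x\<close> take finitely many values.  They determine the points of the orbit, which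
  is therefore finite.\<close>

lemma rational_reduction_imp_quadratic_ge_1:
  assumes x: "x \<ge> 1"
    and rat: "(reduce_fls (q_real x) :: 'a :: {finite, field} fls) \<in> rational_functions"
  shows "quadratic_over \<int> x"
proof -
  define g where "g j = (reduced_limit (digit ((neg_gauss ^^ j) x)) :: 'a fps)" for j
  have "fps_to_fls (g 0) \<in> rational_functions"
    using rat x by (simp add: g_def q_real_eq_q_limit reduce_fls_fps_to_fls reduced_limit_def)
  then obtain a b where "b \<noteq> 0" "g 0 * fps_of_poly b = fps_of_poly a"
    unfolding rational_functions_iff by (auto simp flip: fls_times_fps_to_fls)
  then have g0: "fraction_of_degree (max (degree a) (degree b)) (g 0)"
    unfolding fraction_of_degree_def by (intro exI[of _ a] exI[of _ b]) simp
  have "fraction_of_degree (max (degree a) (degree b)) (g j)" for j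
  proof (induction j)
    case (Suc j)
    show ?case
    proof (rule fraction_of_degree_step[OF Suc])
      show "fps_nth (g (Suc j)) 0 = 1"
        unfolding g_def by (intro reduced_limit_nth_0 digit_ge_2 orbit_ge_1 x)
      show "digit x j \<ge> 1" using digit_ge_2[OF x, of j] by simp
      show "g j * g (Suc j) = fps_of_poly (q_nat_poly (digit x j)) * g (Suc j) - fps_X ^ (digit x j - 1)"
        unfolding g_def by (rule reduced_orbit_recursion[OF x])
    qed
  qed (rule g0)
  then have "finite (range g)"
    by (intro finite_subset[OF _ finite_fractions_of_degree]) blast
  moreover have "inj_on (\<lambda>y. reduced_limit (digit y) :: 'a fps) (range (\<lambda>j. (neg_gauss ^^ j) x))"
  proof (rule inj_onI)
    fix y z assume "y \<in> range (\<lambda>j. (neg_gauss ^^ j) x)" "z \<in> range (\<lambda>j. (neg_gauss ^^ j) x)"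
      and eq: "(reduced_limit (digit y) :: 'a fps) = reduced_limit (digit z)"
    then have "y \<ge> 1" "z \<ge> 1" using orbit_ge_1[OF x] by auto
    then show "y = z"
      using reduced_limit_inject[OF _ _ eq] digit_ge_2 digit_inject by blast
  qed
  ultimately have "finite (range (\<lambda>j. (neg_gauss ^^ j) x))"
    by (intro finite_imageD[of "\<lambda>y. reduced_limit (digit y) :: 'a fps"])
       (simp_all add: image_image g_def)
  then obtain m k where "(neg_gauss ^^ (m + Suc k)) x = (neg_gauss ^^ m) x"
    by (rule finite_orbit_periodic)
  then show ?thesis by (rule periodic_orbit_quadratic[OF x])
qed

lemma rational_reduction_imp_quadratic:
  assumes "(reduce_fls (q_real x) :: 'a :: {finite, field} fls) \<in> rational_functions"
  shows "quadratic_over \<int> x"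
  using assms
proof (induction x rule: q_real.induct)
  case (1 x)
  show ?case
  proof (cases "x \<ge> 1")
    case False
    have "reduce_fls (q_real x) = fls_X_inv * ((reduce_fls (q_real (x + 1)) :: 'a fls) - 1)"
      using False by (subst q_real.simps) (simp add: reduce_fls_shift)
    then have "(reduce_fls (q_real (x + 1)) :: 'a fls) = fls_X * reduce_fls (q_real x) + 1"
      by (simp add: fls_X_mult_X_inv flip: mult.assoc)
    then have "(reduce_fls (q_real (x + 1)) :: 'a fls) \<in> rational_functions"
      using "1.prems" by (simp add: fls_X_rational)
    then have "quadratic_over \<int> (1 * (x + 1) + - 1)"
      using 1(1)[OF False] by (intro Ints.quadratic_affine) simp_all
    then show ?thesis by simp
  qed (rule rational_reduction_imp_quadratic_ge_1[OF _ "1.prems"])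
qed

theorem proposition8p2:
  fixes x :: cantor_line
  shows "(rational_or_quadratic x \<longrightarrow>
            proj_algebraic_over rational_functions (Phi x :: 'p :: prime_card mod_ring fls proj_line) \<and>
            proj_algebraic_degree rational_functions (Phi x :: 'p mod_ring fls proj_line) \<le> 2) \<and>
         ((Phi x :: 'p mod_ring fls proj_line) \<in> proj_points rational_functions \<longrightarrow>
            rational_or_quadratic x)"
proof (intro conjI impI)
  let ?K = "rational_functions :: 'p mod_ring fls set"
  assume x: "rational_or_quadratic x"
  have alg: "proj_algebraic_over ?K (Finite_pt y) \<and> proj_algebraic_degree ?K (Finite_pt y) \<le> 2"
    if "quadratic_over ?K y" for y
    using quadratic_over_algebraic[OF _ that] by simp
  have "proj_algebraic_over ?K (Phi x) \<and> proj_algebraic_degree ?K (Phi x) \<le> 2"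
  proof (cases x)
    case (Irrational y)
    then have "quadratic_over \<int> (Rep_irrational y)"
      using x by (simp add: rational_or_quadratic_def quadratic_irrational_iff)
    then show ?thesis
      unfolding Irrational Phi.simps by (intro alg quadratic_reduction_quadratic)
  next
    case (Rat_plus r)
    show ?thesis
      unfolding Rat_plus Phi.simps
      by (intro alg quadratic_reduction_quadratic rational_quadratic_over_Ints) simp
  next
    case (Rat_minus r)
    show ?thesis
      unfolding Rat_minus Phi.simps
      by (intro alg rational_functions.member_quadratic reduce_q_rat_minus_rational)
  next
    case Plus_infinity
    show ?thesis
      unfolding Plus_infinity Phi.simps
      by (intro alg rational_functions.member_quadratic inverse_rational_function) (simp add: fls_X_rational)
  next
    case Minus_infinity
    then show ?thesis by simp
  qed
  then show "proj_algebraic_over ?K (Phi x)" "proj_algebraic_degree ?K (Phi x) \<le> 2" by auto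
next
  assume Phi: "(Phi x :: 'p mod_ring fls proj_line) \<in> proj_points rational_functions"
  show "rational_or_quadratic x"
  proof (cases x)
    case (Irrational y)
    then have "(reduce_fls (q_real (Rep_irrational y)) :: 'p mod_ring fls) \<in> rational_functions"
      using Phi by (auto simp: proj_points_def)
    then have "quadratic_irrational y"
      unfolding quadratic_irrational_iff by (rule rational_reduction_imp_quadratic)
    then show ?thesis using Irrational by (simp add: rational_or_quadratic_def)
  qed (simp_all add: rational_or_quadratic_def)
qed

end
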